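(* The theory $\mathsf{ITB}+\exists\alpha(\alpha=\alpha)$ proves that there exists a $\prec$-minimal index. Equivalently, the theory $\mathsf{DTB}:=\mathsf{ITB}+\forall\alpha\exists\beta(\beta\prec\alpha)+\exists\alpha(\alpha=\alpha)$ is inconsistent.
   Context: $\mathsf{ITB}$ (iterated truth biconditionals) is a two-sorted first-order theory, in a many-sorted logic allowing the domain of a sort to be empty. The first sort (variables $x,y,z,\dots$) is for natural numbers, the second sort (variables $\alpha,\beta,\gamma,\dots$) is for indices. The language $\mathcal{L}_{\mathsf{ITB}}$ consists of the arithmetic language $\{+,\cdot,\mathsf{S},<,0\}$ on the number sort together with a binary relation $\alpha\prec\beta$ on indices and a binary predicate $\mathsf{T}_\alpha(x)$ (index $\alpha$, number $x$). Axioms: the axioms of Robinson's arithmetic $\mathsf{Q}$; axioms stating that $\prec$ is a strict partial order; and for every $\mathcal{L}_{\mathsf{ITB}}$-sentence $\varphi$ the biconditional $\mathsf{B}_\varphi:=\forall\alpha(\mathsf{T}_\alpha(\ulcorner\varphi\urcorner)\leftrightarrow\varphi^{\prec\alpha})$, where $\ulcorner\varphi\urcorner$ is the numeral of the Gödel number of $\varphi$ (under a standard Gödel numbering of $\mathcal{L}_{\mathsf{ITB}}$) and $\varphi^{\prec\alpha}$ is $\varphi$ with every index quantifier $\forall\beta$ / $\exists\beta$ replaced by $\forall\beta\prec\alpha$ / $\exists\beta\prec\alpha$ (renaming bound variables as needed). *)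

theory Defs
  imports Main "HOL-Library.Nat_Bijection"
begin

text \<open>
  Variables are de Bruijn indices, counted separately for the two sorts: a number variable refers
  to the enclosing number quantifiers only, an index variable to the enclosing index quantifiers
  only. The index sort has no function symbols, so its terms are just variables (type \<^typ>\<open>nat\<close>).
\<close>

datatype nterm =
    NVar nat
  | Zero
  | Succ nterm
  | Plus nterm nterm
  | Times nterm nterm

datatype fm =
    EqNum nterm nterm
  | Less nterm nterm
  | EqIdx nat nat
  | Prec nat nat
  | Tr nat nterm
  | Fls
  | Imp fm fm
  | And fm fm
  | Or fm fm
  | AllNum fm
  | ExNum fm
  | AllIdx fm
  | ExIdx fm

abbreviation Neg :: "fm \<Rightarrow> fm" where
  "Neg A \<equiv> Imp A Fls"

abbreviation Iff :: "fm \<Rightarrow> fm \<Rightarrow> fm" where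
  "Iff A B \<equiv> And (Imp A B) (Imp B A)"

primrec numeral_of :: "nat \<Rightarrow> nterm" where
  "numeral_of 0 = Zero"
| "numeral_of (Suc n) = Succ (numeral_of n)"


subsection \<open>Well-formedness in a context and substitution\<close>

text \<open>\<open>wff m k A\<close>: the free number variables of \<open>A\<close> are among \<open>0, \<dots>, m - 1\<close> and its free index
  variables among \<open>0, \<dots>, k - 1\<close>.\<close>

primrec wft :: "nat \<Rightarrow> nterm \<Rightarrow> bool" where
  "wft m (NVar i) \<longleftrightarrow> i < m"
| "wft m Zero \<longleftrightarrow> True"
| "wft m (Succ t) \<longleftrightarrow> wft m t"
| "wft m (Plus s t) \<longleftrightarrow> wft m s \<and> wft m t"
| "wft m (Times s t) \<longleftrightarrow> wft m s \<and> wft m t"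

primrec wff :: "nat \<Rightarrow> nat \<Rightarrow> fm \<Rightarrow> bool" where
  "wff m k (EqNum s t) \<longleftrightarrow> wft m s \<and> wft m t"
| "wff m k (Less s t) \<longleftrightarrow> wft m s \<and> wft m t"
| "wff m k (EqIdx a b) \<longleftrightarrow> a < k \<and> b < k"
| "wff m k (Prec a b) \<longleftrightarrow> a < k \<and> b < k"
| "wff m k (Tr a t) \<longleftrightarrow> a < k \<and> wft m t"
| "wff m k Fls \<longleftrightarrow> True"
| "wff m k (Imp A B) \<longleftrightarrow> wff m k A \<and> wff m k B"
| "wff m k (And A B) \<longleftrightarrow> wff m k A \<and> wff m k B"
| "wff m k (Or A B) \<longleftrightarrow> wff m k A \<and> wff m k B"
| "wff m k (AllNum A) \<longleftrightarrow> wff (Suc m) k A"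
| "wff m k (ExNum A) \<longleftrightarrow> wff (Suc m) k A"
| "wff m k (AllIdx A) \<longleftrightarrow> wff m (Suc k) A"
| "wff m k (ExIdx A) \<longleftrightarrow> wff m (Suc k) A"

definition sentence :: "fm \<Rightarrow> bool" where
  "sentence A \<longleftrightarrow> wff 0 0 A"

primrec tsubst :: "(nat \<Rightarrow> nterm) \<Rightarrow> nterm \<Rightarrow> nterm" where
  "tsubst \<sigma> (NVar i) = \<sigma> i"
| "tsubst \<sigma> Zero = Zero"
| "tsubst \<sigma> (Succ t) = Succ (tsubst \<sigma> t)"
| "tsubst \<sigma> (Plus s t) = Plus (tsubst \<sigma> s) (tsubst \<sigma> t)"
| "tsubst \<sigma> (Times s t) = Times (tsubst \<sigma> s) (tsubst \<sigma> t)"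

definition up_num :: "(nat \<Rightarrow> nterm) \<Rightarrow> nat \<Rightarrow> nterm" where
  "up_num \<sigma> = case_nat (NVar 0) (\<lambda>i. tsubst (\<lambda>j. NVar (Suc j)) (\<sigma> i))"

definition up_idx :: "(nat \<Rightarrow> nat) \<Rightarrow> nat \<Rightarrow> nat" where
  "up_idx \<rho> = case_nat 0 (\<lambda>i. Suc (\<rho> i))"

text \<open>Capture-avoiding simultaneous substitution, \<open>\<sigma>\<close> for number and \<open>\<rho>\<close> for index variables.\<close>

primrec fsubst :: "(nat \<Rightarrow> nterm) \<Rightarrow> (nat \<Rightarrow> nat) \<Rightarrow> fm \<Rightarrow> fm" where
  "fsubst \<sigma> \<rho> (EqNum s t) = EqNum (tsubst \<sigma> s) (tsubst \<sigma> t)"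
| "fsubst \<sigma> \<rho> (Less s t) = Less (tsubst \<sigma> s) (tsubst \<sigma> t)"
| "fsubst \<sigma> \<rho> (EqIdx a b) = EqIdx (\<rho> a) (\<rho> b)"
| "fsubst \<sigma> \<rho> (Prec a b) = Prec (\<rho> a) (\<rho> b)"
| "fsubst \<sigma> \<rho> (Tr a t) = Tr (\<rho> a) (tsubst \<sigma> t)"
| "fsubst \<sigma> \<rho> Fls = Fls"
| "fsubst \<sigma> \<rho> (Imp A B) = Imp (fsubst \<sigma> \<rho> A) (fsubst \<sigma> \<rho> B)"
| "fsubst \<sigma> \<rho> (And A B) = And (fsubst \<sigma> \<rho> A) (fsubst \<sigma> \<rho> B)"
| "fsubst \<sigma> \<rho> (Or A B) = Or (fsubst \<sigma> \<rho> A) (fsubst \<sigma> \<rho> B)"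
| "fsubst \<sigma> \<rho> (AllNum A) = AllNum (fsubst (up_num \<sigma>) \<rho> A)"
| "fsubst \<sigma> \<rho> (ExNum A) = ExNum (fsubst (up_num \<sigma>) \<rho> A)"
| "fsubst \<sigma> \<rho> (AllIdx A) = AllIdx (fsubst \<sigma> (up_idx \<rho>) A)"
| "fsubst \<sigma> \<rho> (ExIdx A) = ExIdx (fsubst \<sigma> (up_idx \<rho>) A)"

definition lift_num :: "fm \<Rightarrow> fm" where
  "lift_num = fsubst (\<lambda>i. NVar (Suc i)) (\<lambda>a. a)"

definition lift_idx :: "fm \<Rightarrow> fm" where
  "lift_idx = fsubst NVar Suc"

definition inst_num :: "nterm \<Rightarrow> fm \<Rightarrow> fm" where
  "inst_num t = fsubst (case_nat t NVar) (\<lambda>a. a)"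

definition inst_idx :: "nat \<Rightarrow> fm \<Rightarrow> fm" where
  "inst_idx a = fsubst NVar (case_nat a (\<lambda>b. b))"


subsection \<open>Classical natural deduction for possibly empty sorts\<close>

text \<open>
  \<open>derives m k \<Gamma> A\<close>: classical two-sorted natural deduction with equality, in the context of \<open>m\<close>
  free number variables and \<open>k\<close> free index variables. Only the variables of the context may be used
  to instantiate quantifiers; this is what makes the calculus sound for structures in which a sort
  is empty (in the empty context there is no index term through which to pass from \<open>\<forall>\<alpha>. A\<close> to
  \<open>\<exists>\<alpha>. A\<close>).
\<close>

inductive derives :: "nat \<Rightarrow> nat \<Rightarrow> fm set \<Rightarrow> fm \<Rightarrow> bool" where
  Assm: "A \<in> \<Gamma> \<Longrightarrow> wff m k A \<Longrightarrow> derives m k \<Gamma> A"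
| Raa: "wff m k A \<Longrightarrow> derives m k (insert (Neg A) \<Gamma>) Fls \<Longrightarrow> derives m k \<Gamma> A"
| ImpI: "wff m k A \<Longrightarrow> derives m k (insert A \<Gamma>) B \<Longrightarrow> derives m k \<Gamma> (Imp A B)"
| ImpE: "derives m k \<Gamma> (Imp A B) \<Longrightarrow> derives m k \<Gamma> A \<Longrightarrow> derives m k \<Gamma> B"
| AndI: "derives m k \<Gamma> A \<Longrightarrow> derives m k \<Gamma> B \<Longrightarrow> derives m k \<Gamma> (And A B)"
| AndE1: "derives m k \<Gamma> (And A B) \<Longrightarrow> derives m k \<Gamma> A"
| AndE2: "derives m k \<Gamma> (And A B) \<Longrightarrow> derives m k \<Gamma> B"
| OrI1: "wff m k B \<Longrightarrow> derives m k \<Gamma> A \<Longrightarrow> derives m k \<Gamma> (Or A B)"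
| OrI2: "wff m k A \<Longrightarrow> derives m k \<Gamma> B \<Longrightarrow> derives m k \<Gamma> (Or A B)"
| OrE: "derives m k \<Gamma> (Or A B) \<Longrightarrow> derives m k (insert A \<Gamma>) C \<Longrightarrow>
    derives m k (insert B \<Gamma>) C \<Longrightarrow> derives m k \<Gamma> C"
| AllNumI: "derives (Suc m) k (lift_num ` \<Gamma>) A \<Longrightarrow> derives m k \<Gamma> (AllNum A)"
| AllNumE: "wft m t \<Longrightarrow> derives m k \<Gamma> (AllNum A) \<Longrightarrow> derives m k \<Gamma> (inst_num t A)"
| ExNumI: "wff (Suc m) k A \<Longrightarrow> wft m t \<Longrightarrow> derives m k \<Gamma> (inst_num t A) \<Longrightarrow>
    derives m k \<Gamma> (ExNum A)"
| ExNumE: "derives m k \<Gamma> (ExNum A) \<Longrightarrow>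
    derives (Suc m) k (insert A (lift_num ` \<Gamma>)) (lift_num C) \<Longrightarrow> derives m k \<Gamma> C"
| AllIdxI: "derives m (Suc k) (lift_idx ` \<Gamma>) A \<Longrightarrow> derives m k \<Gamma> (AllIdx A)"
| AllIdxE: "a < k \<Longrightarrow> derives m k \<Gamma> (AllIdx A) \<Longrightarrow> derives m k \<Gamma> (inst_idx a A)"
| ExIdxI: "wff m (Suc k) A \<Longrightarrow> a < k \<Longrightarrow> derives m k \<Gamma> (inst_idx a A) \<Longrightarrow>
    derives m k \<Gamma> (ExIdx A)"
| ExIdxE: "derives m k \<Gamma> (ExIdx A) \<Longrightarrow>
    derives m (Suc k) (insert A (lift_idx ` \<Gamma>)) (lift_idx C) \<Longrightarrow> derives m k \<Gamma> C"
| EqNumRefl: "wft m t \<Longrightarrow> derives m k \<Gamma> (EqNum t t)"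
| EqNumSubst: "wff (Suc m) k A \<Longrightarrow> derives m k \<Gamma> (EqNum s t) \<Longrightarrow>
    derives m k \<Gamma> (inst_num s A) \<Longrightarrow> derives m k \<Gamma> (inst_num t A)"
| EqIdxRefl: "a < k \<Longrightarrow> derives m k \<Gamma> (EqIdx a a)"
| EqIdxSubst: "wff m (Suc k) A \<Longrightarrow> derives m k \<Gamma> (EqIdx a b) \<Longrightarrow>
    derives m k \<Gamma> (inst_idx a A) \<Longrightarrow> derives m k \<Gamma> (inst_idx b A)"

definition proves :: "fm set \<Rightarrow> fm \<Rightarrow> bool" (infix "\<turnstile>" 50) where
  "\<Theta> \<turnstile> A \<longleftrightarrow> derives 0 0 \<Theta> A"

definition inconsistent :: "fm set \<Rightarrow> bool" where
  "inconsistent \<Theta> \<longleftrightarrow> \<Theta> \<turnstile> Fls"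


subsection \<open>Goedel numbering\<close>

primrec tcode :: "nterm \<Rightarrow> nat" where
  "tcode (NVar i) = prod_encode (0, i)"
| "tcode Zero = prod_encode (1, 0)"
| "tcode (Succ t) = prod_encode (2, tcode t)"
| "tcode (Plus s t) = prod_encode (3, prod_encode (tcode s, tcode t))"
| "tcode (Times s t) = prod_encode (4, prod_encode (tcode s, tcode t))"

primrec gcode :: "fm \<Rightarrow> nat" where
  "gcode (EqNum s t) = prod_encode (0, prod_encode (tcode s, tcode t))"
| "gcode (Less s t) = prod_encode (1, prod_encode (tcode s, tcode t))"
| "gcode (EqIdx a b) = prod_encode (2, prod_encode (a, b))"
| "gcode (Prec a b) = prod_encode (3, prod_encode (a, b))"
| "gcode (Tr a t) = prod_encode (4, prod_encode (a, tcode t))"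
| "gcode Fls = prod_encode (5, 0)"
| "gcode (Imp A B) = prod_encode (6, prod_encode (gcode A, gcode B))"
| "gcode (And A B) = prod_encode (7, prod_encode (gcode A, gcode B))"
| "gcode (Or A B) = prod_encode (8, prod_encode (gcode A, gcode B))"
| "gcode (AllNum A) = prod_encode (9, gcode A)"
| "gcode (ExNum A) = prod_encode (10, gcode A)"
| "gcode (AllIdx A) = prod_encode (11, gcode A)"
| "gcode (ExIdx A) = prod_encode (12, gcode A)"

lemma tcode_inject: "tcode s = tcode t \<longleftrightarrow> s = t"
proof (induction s arbitrary: t)
  case (NVar i) show ?case by (cases t) auto
next
  case Zero show ?case by (cases t) auto
next
  case (Succ s) then show ?case by (cases t) auto
next
  case (Plus s1 s2) then show ?case by (cases t) auto
next
  case (Times s1 s2) then show ?case by (cases t) auto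
qed

lemma gcode_inject: "gcode A = gcode B \<longleftrightarrow> A = B"
proof (induction A arbitrary: B)
  case (EqNum s t) show ?case by (cases B) (auto simp: tcode_inject)
next
  case (Less s t) show ?case by (cases B) (auto simp: tcode_inject)
next
  case (EqIdx a b) show ?case by (cases B) auto
next
  case (Prec a b) show ?case by (cases B) auto
next
  case (Tr a t) show ?case by (cases B) (auto simp: tcode_inject)
next
  case Fls show ?case by (cases B) auto
next
  case (Imp A1 A2) then show ?case by (cases B) auto
next
  case (And A1 A2) then show ?case by (cases B) auto
next
  case (Or A1 A2) then show ?case by (cases B) auto
next
  case (AllNum A) then show ?case by (cases B) auto
next
  case (ExNum A) then show ?case by (cases B) auto
next
  case (AllIdx A) then show ?case by (cases B) auto
next
  case (ExIdx A) then show ?case by (cases B) auto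
qed


subsection \<open>The theory ITB\<close>

text \<open>\<open>rel a A\<close> is the relativisation \<open>A\<^sup>\<prec>\<^sup>\<alpha>\<close> of the index quantifiers of \<open>A\<close>, where \<open>a\<close> is the
  de Bruijn index of \<open>\<alpha>\<close> at the position of \<open>A\<close>; hence the increment below an index quantifier.\<close>

primrec rel :: "nat \<Rightarrow> fm \<Rightarrow> fm" where
  "rel a (EqNum s t) = EqNum s t"
| "rel a (Less s t) = Less s t"
| "rel a (EqIdx b c) = EqIdx b c"
| "rel a (Prec b c) = Prec b c"
| "rel a (Tr b t) = Tr b t"
| "rel a Fls = Fls"
| "rel a (Imp A B) = Imp (rel a A) (rel a B)"
| "rel a (And A B) = And (rel a A) (rel a B)"
| "rel a (Or A B) = Or (rel a A) (rel a B)"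
| "rel a (AllNum A) = AllNum (rel a A)"
| "rel a (ExNum A) = ExNum (rel a A)"
| "rel a (AllIdx A) = AllIdx (Imp (Prec 0 (Suc a)) (rel (Suc a) A))"
| "rel a (ExIdx A) = ExIdx (And (Prec 0 (Suc a)) (rel (Suc a) A))"

text \<open>For a sentence \<open>A\<close> no lifting is needed when it is placed below the quantifier \<open>\<forall>\<alpha>\<close>: it has
  no free variables.\<close>

definition bicond :: "fm \<Rightarrow> fm" where
  "bicond A = AllIdx (Iff (Tr 0 (numeral_of (gcode A))) (rel 0 A))"

text \<open>The order symbol is governed by \<open>x < y \<longleftrightarrow> (\<exists>z. S z + x = y)\<close>.\<close>

definition Q_axioms :: "fm set" where
  "Q_axioms = {
     AllNum (Neg (EqNum (Succ (NVar 0)) Zero)),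
     AllNum (AllNum (Imp (EqNum (Succ (NVar 1)) (Succ (NVar 0))) (EqNum (NVar 1) (NVar 0)))),
     AllNum (Imp (Neg (EqNum (NVar 0) Zero)) (ExNum (EqNum (NVar 1) (Succ (NVar 0))))),
     AllNum (EqNum (Plus (NVar 0) Zero) (NVar 0)),
     AllNum (AllNum (EqNum (Plus (NVar 1) (Succ (NVar 0))) (Succ (Plus (NVar 1) (NVar 0))))),
     AllNum (EqNum (Times (NVar 0) Zero) Zero),
     AllNum (AllNum (EqNum (Times (NVar 1) (Succ (NVar 0)))
       (Plus (Times (NVar 1) (NVar 0)) (NVar 1)))),
     AllNum (AllNum (Iff (Less (NVar 1) (NVar 0))
       (ExNum (EqNum (Plus (Succ (NVar 0)) (NVar 2)) (NVar 1)))))}"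

definition order_axioms :: "fm set" where
  "order_axioms = {
     AllIdx (Neg (Prec 0 0)),
     AllIdx (AllIdx (AllIdx (Imp (And (Prec 2 1) (Prec 1 0)) (Prec 2 0))))}"

definition ITB :: "fm set" where
  "ITB = Q_axioms \<union> order_axioms \<union> {bicond A |A. sentence A}"

definition index_exists :: fm where
  "index_exists = ExIdx (EqIdx 0 0)"

definition minimal_index_exists :: fm where
  "minimal_index_exists = ExIdx (Neg (ExIdx (Prec 0 1)))"

definition DTB :: "fm set" where
  "DTB = ITB \<union> {AllIdx (ExIdx (Prec 0 1)), index_exists}"

end

theory Submission imports Defs "HOL-Number_Theory.Cong" begin

text \<open>
  Diagonalisation yields a sentence \<open>\<phi>\<close> equivalent to \<open>\<forall>\<beta>. \<not> T\<^sub>\<beta>(\<phi>)\<close>. The equivalence is proved by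
  arithmetic alone, so it survives relativisation, and the biconditional for \<open>\<phi>\<close> becomes
  \<open>T\<^sub>\<alpha>(\<phi>) \<longleftrightarrow> (\<forall>\<beta>\<prec>\<alpha>. \<not> T\<^sub>\<beta>(\<phi>))\<close>. If \<open>T\<^sub>\<alpha>(\<phi>)\<close> and \<open>\<beta> \<prec> \<alpha>\<close>, then \<open>\<phi>\<close> is false at \<open>\<beta>\<close> and, by
  transitivity, at every index below \<open>\<beta>\<close>, whence true at \<open>\<beta>\<close>. So without minimal indices \<open>\<phi>\<close> is false
  at every index, which makes it true at every index.

  For the diagonal lemma, \<open>n \<mapsto> \<ulcorner>\<exists>x (x = n \<and> A)\<urcorner>\<close> (\<open>n\<close> the code of \<open>A\<close>) is described by a bounded formula via
  Goedel's \<open>\<beta>\<close>-function, and Robinson arithmetic decides all numerical instances of bounded formulas.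
\<close>

section \<open>Substitution\<close>

abbreviation lift_t :: "nterm \<Rightarrow> nterm" where
  "lift_t \<equiv> tsubst (\<lambda>j. NVar (Suc j))"

lemma up_num_simps [simp]:
  "up_num \<sigma> 0 = NVar 0"
  "up_num \<sigma> (Suc i) = lift_t (\<sigma> i)"
  by (simp_all add: up_num_def)

lemma up_idx_simps [simp]:
  "up_idx \<rho> 0 = 0"
  "up_idx \<rho> (Suc i) = Suc (\<rho> i)"
  by (simp_all add: up_idx_def)

lemma tsubst_compose: "tsubst \<sigma> (tsubst \<tau> t) = tsubst (\<lambda>i. tsubst \<sigma> (\<tau> i)) t"
  by (induction t) simp_all

lemma tsubst_cong: "wft m t \<Longrightarrow> (\<And>i. i < m \<Longrightarrow> \<sigma> i = \<tau> i) \<Longrightarrow> tsubst \<sigma> t = tsubst \<tau> t"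
  by (induction t) simp_all

lemma tsubst_NVar [simp]: "tsubst NVar t = t"
  by (induction t) simp_all

lemma tsubst_inst_lift [simp]: "tsubst (case_nat s NVar) (lift_t t) = t"
  by (simp add: tsubst_compose)

lemma tsubst_numeral [simp]: "tsubst \<sigma> (numeral_of n) = numeral_of n"
  by (induction n) simp_all

lemma wft_numeral [simp]: "wft m (numeral_of n)"
  by (induction n) simp_all

lemma wft_mono: "wft m t \<Longrightarrow> m \<le> m' \<Longrightarrow> wft m' t"
  by (induction t) simp_all

lemma wft_tsubst: "wft m t \<Longrightarrow> (\<And>i. i < m \<Longrightarrow> wft m' (\<sigma> i)) \<Longrightarrow> wft m' (tsubst \<sigma> t)"
  by (induction t) simp_all

lemma wft_lift [simp]: "wft m t \<Longrightarrow> wft (Suc m) (lift_t t)"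
  by (erule wft_tsubst) simp

lemma up_num_compose: "(\<lambda>i. tsubst (up_num \<sigma>) (up_num \<tau> i)) = up_num (\<lambda>i. tsubst \<sigma> (\<tau> i))"
proof
  fix i show "tsubst (up_num \<sigma>) (up_num \<tau> i) = up_num (\<lambda>i. tsubst \<sigma> (\<tau> i)) i"
    by (cases i) (simp_all add: tsubst_compose)
qed

lemma up_idx_compose: "(\<lambda>i. up_idx \<rho> (up_idx \<rho>' i)) = up_idx (\<lambda>i. \<rho> (\<rho>' i))"
proof
  fix i show "up_idx \<rho> (up_idx \<rho>' i) = up_idx (\<lambda>i. \<rho> (\<rho>' i)) i"
    by (cases i) simp_all
qed

text \<open>Instantiations of several nested quantifiers thereby collapse into one simultaneous
  substitution.\<close>

lemma fsubst_compose:
  "fsubst \<sigma> \<rho> (fsubst \<tau> \<rho>' A) = fsubst (\<lambda>i. tsubst \<sigma> (\<tau> i)) (\<lambda>a. \<rho> (\<rho>' a)) A"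
  by (induction A arbitrary: \<sigma> \<rho> \<tau> \<rho>') (simp_all add: tsubst_compose up_num_compose up_idx_compose)

text \<open>Only free variables matter. This identifies iterated instantiations with a single
  assignment of numerals, and it shows that sentences are fixed by every substitution.\<close>

lemma fsubst_cong:
  assumes "wff m k A" "\<And>i. i < m \<Longrightarrow> \<sigma> i = \<tau> i" "\<And>a. a < k \<Longrightarrow> \<rho> a = \<rho>' a"
  shows "fsubst \<sigma> \<rho> A = fsubst \<tau> \<rho>' A"
  using assms
proof (induction A arbitrary: m k \<sigma> \<tau> \<rho> \<rho>')
  case (EqNum s t)
  then show ?case by (simp add: tsubst_cong[of m _ \<sigma> \<tau>])
next
  case (Less s t)
  then show ?case by (simp add: tsubst_cong[of m _ \<sigma> \<tau>])
next
  case (Tr a t)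
  then show ?case by (simp add: tsubst_cong[of m _ \<sigma> \<tau>])
next
  case (Imp A B)
  then show ?case using Imp.IH[of m k \<sigma> \<tau> \<rho> \<rho>'] by simp
next
  case (And A B)
  then show ?case using And.IH[of m k \<sigma> \<tau> \<rho> \<rho>'] by simp
next
  case (Or A B)
  then show ?case using Or.IH[of m k \<sigma> \<tau> \<rho> \<rho>'] by simp
next
  case (AllNum A)
  have "up_num \<sigma> i = up_num \<tau> i" if "i < Suc m" for i
    using that AllNum.prems by (cases i) auto
  then show ?case
    using AllNum.IH[of "Suc m" k "up_num \<sigma>" "up_num \<tau>" \<rho> \<rho>'] AllNum.prems by simp
next
  case (ExNum A)
  have "up_num \<sigma> i = up_num \<tau> i" if "i < Suc m" for i
    using that ExNum.prems by (cases i) auto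
  then show ?case
    using ExNum.IH[of "Suc m" k "up_num \<sigma>" "up_num \<tau>" \<rho> \<rho>'] ExNum.prems by simp
next
  case (AllIdx A)
  have "up_idx \<rho> i = up_idx \<rho>' i" if "i < Suc k" for i
    using that AllIdx.prems by (cases i) auto
  then show ?case
    using AllIdx.IH[of m "Suc k" \<sigma> \<tau> "up_idx \<rho>" "up_idx \<rho>'"] AllIdx.prems by simp
next
  case (ExIdx A)
  have "up_idx \<rho> i = up_idx \<rho>' i" if "i < Suc k" for i
    using that ExIdx.prems by (cases i) auto
  then show ?case
    using ExIdx.IH[of m "Suc k" \<sigma> \<tau> "up_idx \<rho>" "up_idx \<rho>'"] ExIdx.prems by simp
qed simp_all

lemma up_num_NVar [simp]: "up_num NVar = NVar"
proof
  fix i show "up_num NVar i = NVar i" by (cases i) simp_all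
qed

lemma up_idx_id [simp]: "up_idx (\<lambda>a. a) = (\<lambda>a. a)"
proof
  fix i show "up_idx (\<lambda>a. a) i = i" by (cases i) simp_all
qed

lemma fsubst_id [simp]: "fsubst NVar (\<lambda>a. a) A = A"
  by (induction A) simp_all

lemma wff_mono: "wff m k A \<Longrightarrow> m \<le> m' \<Longrightarrow> k \<le> k' \<Longrightarrow> wff m' k' A"
proof (induction A arbitrary: m k m' k')
  case (EqNum s t)
  then show ?case by (simp add: wft_mono[of m _ m'])
next
  case (Less s t)
  then show ?case by (simp add: wft_mono[of m _ m'])
next
  case (Tr a t)
  then show ?case by (simp add: wft_mono[of m _ m'])
next
  case (Imp A B)
  then show ?case using Imp.IH[of m k m' k'] by simp
next
  case (And A B)
  then show ?case using And.IH[of m k m' k'] by simp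
next
  case (Or A B)
  then show ?case using Or.IH[of m k m' k'] by simp
next
  case (AllNum A)
  then show ?case using AllNum.IH[of "Suc m" k "Suc m'" k'] by simp
next
  case (ExNum A)
  then show ?case using ExNum.IH[of "Suc m" k "Suc m'" k'] by simp
next
  case (AllIdx A)
  then show ?case using AllIdx.IH[of m "Suc k" m' "Suc k'"] by simp
next
  case (ExIdx A)
  then show ?case using ExIdx.IH[of m "Suc k" m' "Suc k'"] by simp
qed simp_all

lemma wff_fsubst:
  assumes "wff m k A" "\<And>i. i < m \<Longrightarrow> wft m' (\<sigma> i)" "\<And>a. a < k \<Longrightarrow> \<rho> a < k'"
  shows "wff m' k' (fsubst \<sigma> \<rho> A)"
  using assms
proof (induction A arbitrary: m k m' k' \<sigma> \<rho>)
  case (EqNum s t)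
  then show ?case by (simp add: wft_tsubst[of m _ m' \<sigma>])
next
  case (Less s t)
  then show ?case by (simp add: wft_tsubst[of m _ m' \<sigma>])
next
  case (Tr a t)
  then show ?case by (simp add: wft_tsubst[of m _ m' \<sigma>])
next
  case (Imp A B)
  then show ?case using Imp.IH[of m k m' \<sigma> \<rho> k'] by simp
next
  case (And A B)
  then show ?case using And.IH[of m k m' \<sigma> \<rho> k'] by simp
next
  case (Or A B)
  then show ?case using Or.IH[of m k m' \<sigma> \<rho> k'] by simp
next
  case (AllNum A)
  have "wft (Suc m') (up_num \<sigma> i)" if "i < Suc m" for i
    using that AllNum.prems by (cases i) auto
  then show ?case
    using AllNum.IH[of "Suc m" k "Suc m'" "up_num \<sigma>" \<rho> k'] AllNum.prems by simp
next
  case (ExNum A)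
  have "wft (Suc m') (up_num \<sigma> i)" if "i < Suc m" for i
    using that ExNum.prems by (cases i) auto
  then show ?case
    using ExNum.IH[of "Suc m" k "Suc m'" "up_num \<sigma>" \<rho> k'] ExNum.prems by simp
next
  case (AllIdx A)
  have "up_idx \<rho> i < Suc k'" if "i < Suc k" for i
    using that AllIdx.prems by (cases i) auto
  then show ?case
    using AllIdx.IH[of m "Suc k" m' \<sigma> "up_idx \<rho>" "Suc k'"] AllIdx.prems by simp
next
  case (ExIdx A)
  have "up_idx \<rho> i < Suc k'" if "i < Suc k" for i
    using that ExIdx.prems by (cases i) auto
  then show ?case
    using ExIdx.IH[of m "Suc k" m' \<sigma> "up_idx \<rho>" "Suc k'"] ExIdx.prems by simp
qed simp_all

lemma fsubst_sentence: "wff 0 0 A \<Longrightarrow> fsubst \<sigma> \<rho> A = A"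
  using fsubst_cong[of 0 0 A \<sigma> NVar \<rho> "\<lambda>a. a"] by simp

lemma lift_num_sentence: "wff 0 0 A \<Longrightarrow> lift_num A = A"
  by (simp add: lift_num_def fsubst_sentence)

lemma lift_idx_sentence: "wff 0 0 A \<Longrightarrow> lift_idx A = A"
  by (simp add: lift_idx_def fsubst_sentence)

lemma lift_num_simps [simp]:
  "lift_num (EqNum s t) = EqNum (lift_t s) (lift_t t)"
  "lift_num (Less s t) = Less (lift_t s) (lift_t t)"
  "lift_num Fls = Fls"
  "lift_num (Imp A B) = Imp (lift_num A) (lift_num B)"
  "lift_num (And A B) = And (lift_num A) (lift_num B)"
  "lift_num (Or A B) = Or (lift_num A) (lift_num B)"
  by (simp_all add: lift_num_def)

section \<open>Derived rules\<close>

lemma derives_mono: "derives m k \<Gamma> A \<Longrightarrow> \<Gamma> \<subseteq> \<Delta> \<Longrightarrow> derives m k \<Delta> A"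
proof (induction arbitrary: \<Delta> rule: derives.induct)
  case (OrE m k \<Gamma> A B C)
  then show ?case by (meson derives.OrE insert_mono)
next
  case (AllNumI m k \<Gamma> A)
  then show ?case by (meson derives.AllNumI image_mono)
next
  case (AllIdxI m k \<Gamma> A)
  then show ?case by (meson derives.AllIdxI image_mono)
next
  case (ExNumE m k \<Gamma> A C)
  then show ?case by (meson derives.ExNumE image_mono insert_mono)
next
  case (ExIdxE m k \<Gamma> A C)
  then show ?case by (meson derives.ExIdxE image_mono insert_mono)
next
  case (AllNumE m t k \<Gamma> A)
  then show ?case by (meson derives.AllNumE)
next
  case (AllIdxE a k m \<Gamma> A)
  then show ?case by (meson derives.AllIdxE)
next
  case (ExNumI m k A t \<Gamma>)
  then show ?case by (meson derives.ExNumI)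
next
  case (ExIdxI m k A a \<Gamma>)
  then show ?case by (meson derives.ExIdxI)
next
  case (EqNumSubst m k A \<Gamma> s t)
  then show ?case by (meson derives.EqNumSubst)
next
  case (EqIdxSubst m k A \<Gamma> a b)
  then show ?case by (meson derives.EqIdxSubst)
next
  case (Raa m k A \<Gamma>)
  then show ?case by (meson derives.Raa insert_mono)
next
  case (ImpI m k A \<Gamma> B)
  then show ?case by (meson derives.ImpI insert_mono)
qed (auto intro: derives.intros)

lemma derives_insert: "derives m k \<Gamma> A \<Longrightarrow> derives m k (insert B \<Gamma>) A"
  by (erule derives_mono) blast

lemma Assm_insert: "wff m k A \<Longrightarrow> derives m k (insert A \<Gamma>) A"
  by (rule Assm) simp_all

lemma FlsE: "derives m k \<Gamma> Fls \<Longrightarrow> wff m k A \<Longrightarrow> derives m k \<Gamma> A"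
  by (blast intro: Raa derives_insert)

lemma NegE: "derives m k \<Gamma> (Neg A) \<Longrightarrow> derives m k \<Gamma> A \<Longrightarrow> wff m k C \<Longrightarrow> derives m k \<Gamma> C"
  by (blast intro: FlsE ImpE)

lemma cut: "derives m k \<Gamma> A \<Longrightarrow> wff m k A \<Longrightarrow> derives m k (insert A \<Gamma>) C \<Longrightarrow> derives m k \<Gamma> C"
  by (blast intro: ImpI ImpE)

text \<open>Once \<open>C\<close> is assumed to fail, each case refutes its own hypothesis, so
  \<open>A\<close> and its negation are refuted together.\<close>

lemma derives_cases:
  assumes "wff m k A" "wff m k C"
    "derives m k (insert A \<Gamma>) C" "derives m k (insert (Neg A) \<Gamma>) C"
  shows "derives m k \<Gamma> C"
proof (rule Raa[OF assms(2)])
  let ?\<Delta> = "insert (Neg C) \<Gamma>"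
  have nC: "derives m k (insert B ?\<Delta>) (Neg C)" for B
    using assms(2) by (intro Assm) auto
  have "derives m k (insert A ?\<Delta>) C" "derives m k (insert (Neg A) ?\<Delta>) C"
    by (rule derives_mono[OF assms(3)] derives_mono[OF assms(4)], blast)+
  then have "derives m k ?\<Delta> (Neg A)" "derives m k ?\<Delta> (Neg (Neg A))"
    using assms(1) by (auto intro!: ImpI intro: ImpE[OF nC])
  then show "derives m k ?\<Delta> Fls" by (blast intro: ImpE)
qed

text \<open>The outer variable has index 1 in the matrix and the inner one index 0; hence
  \<open>t\<close> comes first in the substitution.\<close>

lemma AllNumE2:
  assumes "derives m k \<Gamma> (AllNum (AllNum A))" "wft m s" "wft m t"
  shows "derives m k \<Gamma> (fsubst (case_nat t (case_nat s NVar)) (\<lambda>a. a) A)"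
proof -
  have "(\<lambda>i. tsubst (case_nat t NVar) (up_num (case_nat s NVar) i)) = case_nat t (case_nat s NVar)"
    by (auto simp: up_num_def fun_eq_iff split: nat.split)
  then show ?thesis
    using AllNumE[OF assms(3) AllNumE[OF assms(2,1), unfolded inst_num_def, simplified]]
    by (simp add: inst_num_def fsubst_compose)
qed

section \<open>Congruence rules for equality of numbers\<close>

lemma EqNum_term:
  assumes "derives m k \<Gamma> (EqNum s t)" "wft m s" "wft m t" "wft (Suc m) u"
  shows "derives m k \<Gamma> (EqNum (tsubst (case_nat s NVar) u) (tsubst (case_nat t NVar) u))"
proof -
  \<comment> \<open>The left-hand side is lifted, so that \<open>NVar 0\<close> marks only the
    occurrences in the right-hand side; at \<open>s\<close> the formula is an instance of
    reflexivity.\<close>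
  let ?A = "EqNum (lift_t (tsubst (case_nat s NVar) u)) u"
  have w: "wft m (tsubst (case_nat s NVar) u)"
    using assms by (auto intro!: wft_tsubst[OF assms(4)] split: nat.split)
  have "derives m k \<Gamma> (inst_num s ?A)"
    using w by (simp add: inst_num_def EqNumRefl)
  then have "derives m k \<Gamma> (inst_num t ?A)"
    using w assms by (intro EqNumSubst[OF _ assms(1)]) simp_all
  then show ?thesis by (simp add: inst_num_def)
qed

lemma EqNum_sym:
  assumes "derives m k \<Gamma> (EqNum s t)" "wft m s" "wft m t"
  shows "derives m k \<Gamma> (EqNum t s)"
proof -
  let ?A = "EqNum (NVar 0) (lift_t s)"
  have "derives m k \<Gamma> (inst_num s ?A)"
    using assms by (simp add: inst_num_def EqNumRefl)
  then have "derives m k \<Gamma> (inst_num t ?A)"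
    using assms by (intro EqNumSubst[OF _ assms(1)]) simp_all
  then show ?thesis by (simp add: inst_num_def)
qed

lemma EqNum_trans:
  assumes "derives m k \<Gamma> (EqNum s t)" "derives m k \<Gamma> (EqNum t u)" "wft m s"
  shows "derives m k \<Gamma> (EqNum s u)"
proof -
  let ?A = "EqNum (lift_t s) (NVar 0)"
  have "derives m k \<Gamma> (inst_num t ?A)"
    using assms by (simp add: inst_num_def)
  then have "derives m k \<Gamma> (inst_num u ?A)"
    using assms by (intro EqNumSubst[OF _ assms(2)]) simp_all
  then show ?thesis by (simp add: inst_num_def)
qed

lemma EqNum_Succ:
  assumes "derives m k \<Gamma> (EqNum s t)" "wft m s" "wft m t"
  shows "derives m k \<Gamma> (EqNum (Succ s) (Succ t))"
  using EqNum_term[OF assms, of "Succ (NVar 0)"] by simp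

lemma EqNum_Plus:
  assumes "derives m k \<Gamma> (EqNum s t)" "derives m k \<Gamma> (EqNum s' t')"
    and "wft m s" "wft m t" "wft m s'" "wft m t'"
  shows "derives m k \<Gamma> (EqNum (Plus s s') (Plus t t'))"
  using EqNum_term[OF assms(1,3,4), of "Plus (NVar 0) (lift_t s')"]
    EqNum_term[OF assms(2,5,6), of "Plus (lift_t t) (NVar 0)"] assms
  by (auto intro: EqNum_trans)

lemma EqNum_Times:
  assumes "derives m k \<Gamma> (EqNum s t)" "derives m k \<Gamma> (EqNum s' t')"
    and "wft m s" "wft m t" "wft m s'" "wft m t'"
  shows "derives m k \<Gamma> (EqNum (Times s s') (Times t t'))"
  using EqNum_term[OF assms(1,3,4), of "Times (NVar 0) (lift_t s')"]
    EqNum_term[OF assms(2,5,6), of "Times (lift_t t) (NVar 0)"] assms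
  by (auto intro: EqNum_trans)

lemma EqNum_Less:
  assumes "derives m k \<Gamma> (EqNum s t)" "derives m k \<Gamma> (EqNum s' t')" "derives m k \<Gamma> (Less s s')"
    and "wft m s" "wft m t" "wft m s'" "wft m t'"
  shows "derives m k \<Gamma> (Less t t')"
proof -
  have "derives m k \<Gamma> (inst_num t (Less (NVar 0) (lift_t s')))"
    using assms by (intro EqNumSubst[OF _ assms(1)]) (simp_all add: inst_num_def)
  then have "derives m k \<Gamma> (inst_num t' (Less (lift_t t) (NVar 0)))"
    using assms by (intro EqNumSubst[OF _ assms(2)]) (simp_all add: inst_num_def)
  then show ?thesis by (simp add: inst_num_def)
qed

text \<open>Leibniz' law for one variable inside a simultaneous substitution: \<open>B\<close> turns
  variable \<open>i\<close> into the hole \<open>NVar 0\<close> and lifts all other terms out of its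
  way.\<close>

lemma fsubst_EqNum:
  assumes "derives m k \<Gamma> (EqNum s t)" "derives m k \<Gamma> (fsubst (\<sigma>(i := s)) (\<lambda>a. a) A)"
    and "wff m' k A" "\<And>j. j < m' \<Longrightarrow> wft m (\<sigma> j)"
  shows "derives m k \<Gamma> (fsubst (\<sigma>(i := t)) (\<lambda>a. a) A)"
proof -
  define B where "B = fsubst (\<lambda>j. if j = i then NVar 0 else lift_t (\<sigma> j)) (\<lambda>a. a) A"
  have inst: "inst_num u B = fsubst (\<sigma>(i := u)) (\<lambda>a. a) A" for u
    unfolding inst_num_def B_def fsubst_compose
    by (rule arg_cong[where f = "\<lambda>\<tau>. fsubst \<tau> _ A"]) auto
  have "wff (Suc m) k B"
    unfolding B_def using assms(3,4) by (auto intro: wff_fsubst)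
  then show ?thesis
    using EqNumSubst[OF _ assms(1), of B] assms(2) by (simp add: inst)
qed

section \<open>Robinson arithmetic\<close>

lemma Q_sentences: "A \<in> Q_axioms \<Longrightarrow> wff 0 0 A"
  unfolding Q_axioms_def by auto

text \<open>The axioms are sentences and thus fixed by lifting, so they remain among the hypotheses
  when a quantifier rule introduces a fresh variable.\<close>

lemma Q_lift: "Q_axioms \<subseteq> \<Gamma> \<Longrightarrow> Q_axioms \<subseteq> lift_num ` \<Gamma>"
  by (force simp: image_iff lift_num_sentence dest: Q_sentences)

lemma Q_insert: "Q_axioms \<subseteq> \<Gamma> \<Longrightarrow> Q_axioms \<subseteq> insert A \<Gamma>"
  by blast

lemma Q_derives: "Q_axioms \<subseteq> \<Gamma> \<Longrightarrow> A \<in> Q_axioms \<Longrightarrow> derives m k \<Gamma> A"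
  by (blast intro: Assm wff_mono[OF Q_sentences, of _ m k])

context
  fixes m k :: nat and \<Gamma> :: "fm set"
  assumes Q: "Q_axioms \<subseteq> \<Gamma>"
begin

lemma Q_Succ_neq_Zero: "wft m t \<Longrightarrow> derives m k \<Gamma> (Neg (EqNum (Succ t) Zero))"
  using AllNumE[OF _ Q_derives[OF Q], of m t "Neg (EqNum (Succ (NVar 0)) Zero)" k]
  by (simp add: Q_axioms_def inst_num_def)

lemma Q_Succ_inj:
  assumes "wft m s" "wft m t"
  shows "derives m k \<Gamma> (Imp (EqNum (Succ s) (Succ t)) (EqNum s t))"
  using AllNumE2[OF Q_derives[OF Q] assms,
      of "Imp (EqNum (Succ (NVar 1)) (Succ (NVar 0))) (EqNum (NVar 1) (NVar 0))"]
  by (simp add: Q_axioms_def)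

lemma Q_Zero_or_Succ:
  assumes "wft m t"
  shows "derives m k \<Gamma> (Imp (Neg (EqNum t Zero)) (ExNum (EqNum (lift_t t) (Succ (NVar 0)))))"
  using AllNumE[OF assms Q_derives[OF Q],
      of "Imp (Neg (EqNum (NVar 0) Zero)) (ExNum (EqNum (NVar 1) (Succ (NVar 0))))" k]
  by (simp add: Q_axioms_def inst_num_def)

lemma Q_Plus_Zero: "wft m t \<Longrightarrow> derives m k \<Gamma> (EqNum (Plus t Zero) t)"
  using AllNumE[OF _ Q_derives[OF Q], of m t "EqNum (Plus (NVar 0) Zero) (NVar 0)" k]
  by (simp add: Q_axioms_def inst_num_def)

lemma Q_Plus_Succ:
  assumes "wft m s" "wft m t"
  shows "derives m k \<Gamma> (EqNum (Plus s (Succ t)) (Succ (Plus s t)))"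
  using AllNumE2[OF Q_derives[OF Q] assms,
      of "EqNum (Plus (NVar 1) (Succ (NVar 0))) (Succ (Plus (NVar 1) (NVar 0)))"]
  by (simp add: Q_axioms_def)

lemma Q_Times_Zero: "wft m t \<Longrightarrow> derives m k \<Gamma> (EqNum (Times t Zero) Zero)"
  using AllNumE[OF _ Q_derives[OF Q], of m t "EqNum (Times (NVar 0) Zero) Zero" k]
  by (simp add: Q_axioms_def inst_num_def)

lemma Q_Times_Succ:
  assumes "wft m s" "wft m t"
  shows "derives m k \<Gamma> (EqNum (Times s (Succ t)) (Plus (Times s t) s))"
  using AllNumE2[OF Q_derives[OF Q] assms,
      of "EqNum (Times (NVar 1) (Succ (NVar 0))) (Plus (Times (NVar 1) (NVar 0)) (NVar 1))"]
  by (simp add: Q_axioms_def)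

lemma Q_Less:
  assumes "wft m s" "wft m t"
  shows "derives m k \<Gamma>
    (Iff (Less s t) (ExNum (EqNum (Plus (Succ (NVar 0)) (lift_t s)) (lift_t t))))"
  using AllNumE2[OF Q_derives[OF Q] assms,
      of "Iff (Less (NVar 1) (NVar 0)) (ExNum (EqNum (Plus (Succ (NVar 0)) (NVar 2)) (NVar 1)))"]
  by (simp add: Q_axioms_def numeral_2_eq_2)

lemma Q_LessI:
  assumes "derives m k \<Gamma> (EqNum (Plus (Succ u) s) t)" "wft m s" "wft m t" "wft m u"
  shows "derives m k \<Gamma> (Less s t)"
  using assms
  by (intro ImpE[OF AndE2[OF Q_Less]] ExNumI[where t = u]) (simp_all add: inst_num_def)

lemma Q_LessE:
  assumes "derives m k \<Gamma> (Less s t)" "wft m s" "wft m t"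
    and "derives (Suc m) k (insert (EqNum (Plus (Succ (NVar 0)) (lift_t s)) (lift_t t)) (lift_num ` \<Gamma>))
      (lift_num C)"
  shows "derives m k \<Gamma> C"
  using ExNumE[OF ImpE[OF AndE1[OF Q_Less] assms(1)]] assms by blast

text \<open>Robinson arithmetic has no induction; arguments about an arbitrary number combine this
  case distinction with induction in the metatheory.\<close>

lemma Q_nat_cases:
  assumes "wft m t" "wff m k C" "derives m k (insert (EqNum t Zero) \<Gamma>) C"
    and "derives (Suc m) k (insert (EqNum (lift_t t) (Succ (NVar 0))) (lift_num ` \<Gamma>)) (lift_num C)"
  shows "derives m k \<Gamma> C"
proof (rule derives_cases[OF _ assms(2,3)])
  have "derives m k \<Gamma> (Imp (ExNum (EqNum (lift_t t) (Succ (NVar 0)))) C)"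
  proof (rule ImpI)
    show "derives m k (insert (ExNum (EqNum (lift_t t) (Succ (NVar 0)))) \<Gamma>) C"
      using assms(1,4) by (intro ExNumE[OF Assm_insert]) (auto elim: derives_mono)
  qed (use assms in simp)
  then show "derives m k (insert (Neg (EqNum t Zero)) \<Gamma>) C"
    using Q_Zero_or_Succ[OF assms(1)] assms(1)
    by (meson Assm_insert ImpE derives_insert wff.simps wft.simps)
qed (use assms in simp)

end

section \<open>Computation with numerals\<close>

lemma Q_Plus_numeral:
  assumes "Q_axioms \<subseteq> \<Gamma>" "wft m s"
  shows "derives m k \<Gamma> (EqNum (Plus s (numeral_of n)) ((Succ ^^ n) s))"
proof -
  have w: "wft m ((Succ ^^ n) s)" for n using assms(2) by (induction n) simp_all
  show ?thesis
  proof (induction n)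
    case 0
    then show ?case using assms by (simp add: Q_Plus_Zero)
  next
    case (Suc n)
    have "derives m k \<Gamma> (EqNum (Succ (Plus s (numeral_of n))) (Succ ((Succ ^^ n) s)))"
      using Suc assms w by (intro EqNum_Succ) simp_all
    then show ?case
      using assms by (auto intro: EqNum_trans[OF Q_Plus_Succ])
  qed
qed

lemma Succ_funpow_numeral: "(Succ ^^ n) (numeral_of j) = numeral_of (j + n)"
  by (induction n) simp_all

lemma Q_Times_numeral:
  assumes "Q_axioms \<subseteq> \<Gamma>"
  shows "derives m k \<Gamma> (EqNum (Times (numeral_of j) (numeral_of n)) (numeral_of (j * n)))"
proof (induction n)
  case 0
  then show ?case using assms by (simp add: Q_Times_Zero)
next
  case (Suc n)
  have "derives m k \<Gamma> (EqNum (Plus (Times (numeral_of j) (numeral_of n)) (numeral_of j))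
      (Plus (numeral_of (j * n)) (numeral_of j)))"
    using Suc by (intro EqNum_Plus EqNumRefl) simp_all
  moreover have "derives m k \<Gamma> (EqNum (Plus (numeral_of (j * n)) (numeral_of j)) (numeral_of (j * Suc n)))"
    using Q_Plus_numeral[OF assms, of m "numeral_of (j * n)" k j]
    by (simp add: Succ_funpow_numeral add.commute)
  ultimately show ?case
    using EqNum_trans[OF Q_Times_Succ[OF assms] EqNum_trans] by simp
qed

primrec tval :: "(nat \<Rightarrow> nat) \<Rightarrow> nterm \<Rightarrow> nat" where
  "tval e (NVar i) = e i"
| "tval e Zero = 0"
| "tval e (Succ t) = Suc (tval e t)"
| "tval e (Plus s t) = tval e s + tval e t"
| "tval e (Times s t) = tval e s * tval e t"

lemma wft_closing [simp]: "wft m (tsubst (\<lambda>i. numeral_of (e i)) t)"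
  by (induction t) simp_all

lemma Q_tval:
  assumes "Q_axioms \<subseteq> \<Gamma>"
  shows "derives m k \<Gamma> (EqNum (tsubst (\<lambda>i. numeral_of (e i)) t) (numeral_of (tval e t)))"
proof (induction t)
  case (Plus s t)
  show ?case
    using EqNum_trans[OF EqNum_Plus[OF Plus] Q_Plus_numeral[OF assms]]
    by (simp add: Succ_funpow_numeral)
next
  case (Times s t)
  show ?case
    using EqNum_trans[OF EqNum_Times[OF Times] Q_Times_numeral[OF assms]] by simp
qed (simp_all add: EqNumRefl EqNum_Succ)

text \<open>Injectivity peels successors off both sides until exactly one side is
  \<open>Zero\<close>.\<close>

lemma Q_numeral_neq:
  assumes "Q_axioms \<subseteq> \<Gamma>" "i \<noteq> j"
  shows "derives m k \<Gamma> (Neg (EqNum (numeral_of i) (numeral_of j)))"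
  using assms
proof (induction i arbitrary: j \<Gamma>)
  case 0
  then obtain j' where "j = Suc j'" by (cases j) auto
  then show ?case using 0
    by (auto intro!: ImpI ImpE[OF Q_Succ_neq_Zero[of _ m "numeral_of j'"]] EqNum_sym[OF Assm_insert])
next
  case (Suc i)
  show ?case
  proof (cases j)
    case 0
    then show ?thesis using Suc.prems by (simp add: Q_Succ_neq_Zero)
  next
    case (Suc j')
    let ?\<Delta> = "insert (EqNum (Succ (numeral_of i)) (Succ (numeral_of j'))) \<Gamma>"
    have Q: "Q_axioms \<subseteq> ?\<Delta>" using Suc.prems(1) by blast
    have "derives m k ?\<Delta> (EqNum (numeral_of i) (numeral_of j'))"
      by (rule ImpE[OF Q_Succ_inj[OF Q]]) (simp_all add: Assm_insert)
    then have "derives m k ?\<Delta> Fls"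
      using Suc.IH[OF Q, of j'] Suc.prems Suc by (auto intro: ImpE)
    then show ?thesis using Suc by (auto intro: ImpI)
  qed
qed

lemma Q_numeral_Less:
  assumes "Q_axioms \<subseteq> \<Gamma>" "i < j"
  shows "derives m k \<Gamma> (Less (numeral_of i) (numeral_of j))"
\<comment> \<open>The order axiom asks for \<open>z\<close> with \<open>S z + i = j\<close>.\<close>
proof (rule Q_LessI[OF assms(1), where u = "numeral_of (j - Suc i)"])
  show "derives m k \<Gamma> (EqNum (Plus (Succ (numeral_of (j - Suc i))) (numeral_of i)) (numeral_of j))"
    using Q_Plus_numeral[OF assms(1), of m "numeral_of (Suc (j - Suc i))" k i] assms(2)
    by (simp only: Succ_funpow_numeral) simp
qed simp_all

text \<open>The internal counterpart of \<open>t < n\<close> for a standard bound: it turns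
  reasoning below a numeral into a finite case distinction.\<close>

primrec one_of :: "nat \<Rightarrow> nterm \<Rightarrow> fm" where
  "one_of 0 t = Fls"
| "one_of (Suc n) t = Or (one_of n t) (EqNum t (numeral_of n))"

lemma wff_one_of [simp]: "wft m t \<Longrightarrow> wff m k (one_of n t)"
  by (induction n) simp_all

lemma lift_one_of [simp]: "lift_num (one_of n t) = one_of n (lift_t t)"
  by (induction n) simp_all

lemma one_ofI:
  assumes "i < n" "derives m k \<Gamma> (EqNum t (numeral_of i))" "wft m t"
  shows "derives m k \<Gamma> (one_of n t)"
  using assms
proof (induction n)
  case (Suc n)
  then show ?case by (cases "i = n") (auto intro: OrI1 OrI2)
qed simp

lemma one_ofE:
  assumes "derives m k \<Gamma> (one_of n t)" "wff m k C"
    and "\<And>i. i < n \<Longrightarrow> derives m k (insert (EqNum t (numeral_of i)) \<Gamma>) C" "wft m t"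
  shows "derives m k \<Gamma> C"
  using assms
proof (induction n arbitrary: \<Gamma>)
  case 0
  then show ?case by (auto intro: FlsE)
next
  case (Suc n)
  let ?\<Delta> = "insert (one_of n t) \<Gamma>"
  have "derives m k ?\<Delta> C"
  proof (rule Suc.IH)
    fix i assume "i < n"
    then have "derives m k (insert (EqNum t (numeral_of i)) \<Gamma>) C" using Suc.prems(3) by simp
    then show "derives m k (insert (EqNum t (numeral_of i)) ?\<Delta>) C" by (rule derives_mono) blast
  qed (use Suc.prems in \<open>simp_all add: Assm_insert\<close>)
  then show ?case using Suc.prems by (auto intro: OrE)
qed

lemma EqNum_Plus_right:
  assumes "derives m k \<Gamma> (EqNum t u)" "derives m k \<Gamma> (EqNum (Plus s t) v)"
    and "wft m s" "wft m t" "wft m u"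
  shows "derives m k \<Gamma> (EqNum (Plus s u) v)"
  using assms
  by (intro EqNum_trans[OF EqNum_Plus[OF EqNumRefl EqNum_sym[OF assms(1)]] assms(2)]) simp_all

text \<open>Induction on \<open>n\<close> outside, case distinction on \<open>t\<close> inside. If
  \<open>t = S t'\<close>, a successor is peeled off both sides of
  \<open>S s + S t' = n + 1\<close>, which leaves \<open>S s + t' = n\<close>. For
  \<open>n = 0\<close> both cases make a successor equal to zero. The terms and the context are
  general because \<open>t'\<close> is a fresh variable.\<close>

lemma Q_Plus_eq_numeral:
  assumes "Q_axioms \<subseteq> \<Gamma>" "wft m s" "wft m t"
  shows "derives m k (insert (EqNum (Plus (Succ s) t) (numeral_of n)) \<Gamma>) (one_of n t)"
  using assms
proof (induction n arbitrary: m s t \<Gamma>)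
  case 0
  let ?\<Gamma> = "insert (EqNum (Plus (Succ s) t) (numeral_of 0)) \<Gamma>"
  show ?case
  proof (rule Q_nat_cases[OF _ 0(3)])
    let ?\<Delta> = "insert (EqNum t Zero) ?\<Gamma>"
    have Q: "Q_axioms \<subseteq> ?\<Delta>" using 0 by blast
    have "derives m k ?\<Delta> (EqNum (Plus (Succ s) Zero) Zero)"
      using 0 by (intro EqNum_Plus_right[where t = t, OF Assm Assm]) simp_all
    then have "derives m k ?\<Delta> (EqNum (Succ s) Zero)"
      using 0 by - (rule EqNum_trans[OF EqNum_sym[OF Q_Plus_Zero[OF Q]]], simp_all)
    then show "derives m k ?\<Delta> (one_of 0 t)"
      using Q_Succ_neq_Zero[OF Q 0(2)] by (auto intro: ImpE)
  next
    let ?\<Delta> = "insert (EqNum (lift_t t) (Succ (NVar 0))) (lift_num ` ?\<Gamma>)"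
    let ?s = "Plus (Succ (lift_t s)) (NVar 0)"
    have Q: "Q_axioms \<subseteq> ?\<Delta>" by (intro Q_insert Q_lift 0)
    have "derives (Suc m) k ?\<Delta> (EqNum (Plus (Succ (lift_t s)) (Succ (NVar 0))) Zero)"
      using 0 by (intro EqNum_Plus_right[where t = "lift_t t", OF Assm Assm]) simp_all
    then have "derives (Suc m) k ?\<Delta> (EqNum (Succ ?s) Zero)"
      using 0 by - (rule EqNum_trans[OF EqNum_sym[OF Q_Plus_Succ[OF Q]]], simp_all)
    then show "derives (Suc m) k ?\<Delta> (lift_num (one_of 0 t))"
      using Q_Succ_neq_Zero[OF Q, of "Suc m" ?s k] 0 by (auto intro: ImpE)
  qed (use 0 in auto)
next
  case (Suc n)
  let ?\<Gamma> = "insert (EqNum (Plus (Succ s) t) (numeral_of (Suc n))) \<Gamma>"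
  show ?case
  proof (rule Q_nat_cases[OF _ Suc.prems(3)])
    show "derives m k (insert (EqNum t Zero) ?\<Gamma>) (one_of (Suc n) t)"
      using Suc.prems by (intro one_ofI[where i = 0] Assm) simp_all
  next
    let ?\<Delta> = "insert (EqNum (lift_t t) (Succ (NVar 0))) (lift_num ` ?\<Gamma>)"
    let ?s = "Plus (Succ (lift_t s)) (NVar 0)"
    have Q: "Q_axioms \<subseteq> ?\<Delta>" by (intro Q_insert Q_lift Suc.prems)
    have "derives (Suc m) k ?\<Delta> (EqNum (Plus (Succ (lift_t s)) (Succ (NVar 0))) (numeral_of (Suc n)))"
      using Suc.prems by (intro EqNum_Plus_right[where t = "lift_t t", OF Assm Assm]) simp_all
    then have "derives (Suc m) k ?\<Delta> (EqNum (Succ ?s) (Succ (numeral_of n)))"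
      using Suc.prems by - (rule EqNum_trans[OF EqNum_sym[OF Q_Plus_Succ[OF Q]]], simp_all)
    then have "derives (Suc m) k ?\<Delta> (EqNum ?s (numeral_of n))"
      using Suc.prems by - (rule ImpE[OF Q_Succ_inj[OF Q]], simp_all)
    then have "derives (Suc m) k ?\<Delta> (one_of n (NVar 0))"
      by (rule cut[OF _ _ Suc.IH[OF Q]]) (use Suc.prems in simp_all)
    then show "derives (Suc m) k ?\<Delta> (lift_num (one_of (Suc n) t))"
    proof (rule one_ofE)
      fix i assume "i < n"
      let ?\<Theta> = "insert (EqNum (NVar 0) (numeral_of i)) ?\<Delta>"
      have "derives (Suc m) k ?\<Theta> (EqNum (Succ (NVar 0)) (Succ (numeral_of i)))"
        by (intro EqNum_Succ Assm_insert) simp_all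
      then have "derives (Suc m) k ?\<Theta> (EqNum (lift_t t) (numeral_of (Suc i)))"
        using Suc.prems by - (rule EqNum_trans[where t = "Succ (NVar 0)", OF Assm], simp_all)
      then show "derives (Suc m) k ?\<Theta> (lift_num (one_of (Suc n) t))"
        using \<open>i < n\<close> Suc.prems unfolding lift_one_of by (intro one_ofI[where i = "Suc i"]) simp_all
    qed (use Suc.prems in simp_all)
  qed (use Suc.prems in auto)
qed

lemma Q_Less_numeral:
  assumes "Q_axioms \<subseteq> \<Gamma>" "wft m t"
  shows "derives m k (insert (Less t (numeral_of n)) \<Gamma>) (one_of n t)"
proof (rule Q_LessE[OF _ Assm_insert])
  show "derives (Suc m) k (insert (EqNum (Plus (Succ (NVar 0)) (lift_t t)) (lift_t (numeral_of n)))
      (lift_num ` insert (Less t (numeral_of n)) \<Gamma>)) (lift_num (one_of n t))"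
    unfolding lift_one_of tsubst_numeral using assms
    by (intro Q_Plus_eq_numeral Q_lift) auto
qed (use assms in auto)

text \<open>If \<open>i < j\<close> held internally, the numeral of \<open>i\<close> would equal the
  numeral of some \<open>l < j\<close>, but distinct numerals are provably different.\<close>

lemma Q_numeral_not_Less:
  assumes "Q_axioms \<subseteq> \<Gamma>" "\<not> i < j"
  shows "derives m k \<Gamma> (Neg (Less (numeral_of i) (numeral_of j)))"
proof (rule ImpI, simp)
  show "derives m k (insert (Less (numeral_of i) (numeral_of j)) \<Gamma>) Fls"
  proof (rule one_ofE[OF Q_Less_numeral[OF assms(1)]])
    fix l assume "l < j"
    let ?\<Theta> = "insert (EqNum (numeral_of i) (numeral_of l)) (insert (Less (numeral_of i) (numeral_of j)) \<Gamma>)"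
    have "Q_axioms \<subseteq> ?\<Theta>" using assms by blast
    then show "derives m k ?\<Theta> Fls"
      using assms \<open>l < j\<close> by (intro ImpE[OF Q_numeral_neq Assm_insert]) auto
  qed simp_all
qed

text \<open>The witness for \<open>s < t\<close> serves again, since
  \<open>S z + S s = S (S z + s)\<close>.\<close>

lemma Q_Less_Succ:
  assumes "Q_axioms \<subseteq> \<Gamma>" "derives m k \<Gamma> (Less s t)" "wft m s" "wft m t"
  shows "derives m k \<Gamma> (Less (Succ s) (Succ t))"
proof (rule Q_LessE[OF assms])
  let ?\<Delta> = "insert (EqNum (Plus (Succ (NVar 0)) (lift_t s)) (lift_t t)) (lift_num ` \<Gamma>)"
  have Q: "Q_axioms \<subseteq> ?\<Delta>" by (intro Q_insert Q_lift assms)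
  have "derives (Suc m) k ?\<Delta> (EqNum (Plus (Succ (NVar 0)) (Succ (lift_t s))) (Succ (lift_t t)))"
    using assms by (intro EqNum_trans[OF Q_Plus_Succ[OF Q]] EqNum_Succ Assm_insert) simp_all
  then show "derives (Suc m) k ?\<Delta> (lift_num (Less (Succ s) (Succ t)))"
    using assms by (auto intro: Q_LessI[OF Q])
qed

text \<open>Compares an arbitrary, possibly nonstandard number with a standard one. Since one side
  is a numeral, induction outside suffices: the predecessor of \<open>t\<close> is compared with
  \<open>n\<close> and the result is carried up by \<open>Q_Less_Succ\<close>.\<close>

lemma Q_trichotomy:
  assumes "Q_axioms \<subseteq> \<Gamma>" "wft m t"
  shows "derives m k \<Gamma> (Or (Less t (numeral_of n)) (Or (EqNum t (numeral_of n)) (Less (numeral_of n) t)))"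
  using assms
proof (induction n arbitrary: m t \<Gamma>)
  case 0
  let ?C = "Or (Less t Zero) (Or (EqNum t Zero) (Less Zero t))"
  have "derives m k \<Gamma> ?C"
  proof (rule Q_nat_cases[OF 0])
    show "derives m k (insert (EqNum t Zero) \<Gamma>) ?C"
      using 0 by (intro OrI2 OrI1 Assm) simp_all
  next
    let ?\<Delta> = "insert (EqNum (lift_t t) (Succ (NVar 0))) (lift_num ` \<Gamma>)"
    have Q: "Q_axioms \<subseteq> ?\<Delta>" by (intro Q_insert Q_lift 0)
    \<comment> \<open>The predecessor of \<open>t\<close> witnesses \<open>0 < t\<close>.\<close>
    have "derives (Suc m) k ?\<Delta> (EqNum (Plus (Succ (NVar 0)) Zero) (lift_t t))"
      using 0 by (intro EqNum_trans[OF Q_Plus_Zero[OF Q] EqNum_sym[OF Assm_insert]]) simp_all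
    then show "derives (Suc m) k ?\<Delta> (lift_num ?C)"
      using 0 by (auto intro!: OrI2 Q_LessI[OF Q, where u = "NVar 0"])
  qed (use 0 in simp)
  then show ?case by simp
next
  case (Suc n)
  let ?C = "Or (Less t (numeral_of (Suc n))) (Or (EqNum t (numeral_of (Suc n))) (Less (numeral_of (Suc n)) t))"
  show ?case
  proof (rule Q_nat_cases[OF Suc.prems])
    let ?\<Delta> = "insert (EqNum t Zero) \<Gamma>"
    have Q: "Q_axioms \<subseteq> ?\<Delta>" by (intro Q_insert Suc.prems)
    have "derives m k ?\<Delta> (Less t (numeral_of (Suc n)))"
      using Suc.prems Q_numeral_Less[OF Q, of 0 "Suc n" m k]
      by - (rule EqNum_Less[OF EqNum_sym[OF Assm_insert] EqNumRefl], simp_all)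
    then show "derives m k ?\<Delta> ?C" using Suc.prems by (intro OrI1) simp_all
  next
    let ?\<Delta> = "insert (EqNum (lift_t t) (Succ (NVar 0))) (lift_num ` \<Gamma>)"
    have Q: "Q_axioms \<subseteq> ?\<Delta>" by (intro Q_insert Q_lift Suc.prems)
    have eq: "derives (Suc m) k (insert A ?\<Delta>) (EqNum (Succ (NVar 0)) (lift_t t))" for A
      using Suc.prems by (intro EqNum_sym[OF Assm]) simp_all
    have Q': "Q_axioms \<subseteq> insert A ?\<Delta>" for A using Q by blast
    show "derives (Suc m) k ?\<Delta> (lift_num ?C)"
    proof (rule OrE[OF Suc.IH[OF Q, of "Suc m" "NVar 0"]])
      show "derives (Suc m) k (insert (Less (NVar 0) (numeral_of n)) ?\<Delta>) (lift_num ?C)"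
        using Suc.prems
        by (auto intro!: OrI1 EqNum_Less[OF eq EqNumRefl Q_Less_Succ[OF Q' Assm_insert]])
    next
      let ?D = "Or (EqNum (NVar 0) (numeral_of n)) (Less (numeral_of n) (NVar 0))"
      have "derives (Suc m) k (insert (EqNum (NVar 0) (numeral_of n)) ?\<Delta>)
          (EqNum (lift_t t) (Succ (numeral_of n)))"
        using Suc.prems
        by (intro EqNum_trans[OF EqNum_sym[OF eq] EqNum_Succ[OF Assm_insert]]) simp_all
      then have "derives (Suc m) k (insert (EqNum (NVar 0) (numeral_of n)) ?\<Delta>) (lift_num ?C)"
        using Suc.prems OrI2[OF _ OrI1] by simp
      moreover have "derives (Suc m) k (insert (Less (numeral_of n) (NVar 0)) ?\<Delta>) (lift_num ?C)"
        using Suc.prems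
        by (auto intro!: OrI2 EqNum_Less[OF EqNumRefl eq Q_Less_Succ[OF Q' Assm_insert]])
      ultimately show "derives (Suc m) k (insert ?D ?\<Delta>) (lift_num ?C)"
        by (intro OrE[OF Assm_insert]) (auto elim: derives_mono)
    qed simp
  qed (use Suc.prems in simp)
qed

section \<open>Bounded formulas\<close>

text \<open>Truth in the standard natural numbers; atoms and quantifiers of the index sort get the
  default value \<open>False\<close>.\<close>

primrec tv :: "(nat \<Rightarrow> nat) \<Rightarrow> fm \<Rightarrow> bool" where
  "tv e (EqNum s t) \<longleftrightarrow> tval e s = tval e t"
| "tv e (Less s t) \<longleftrightarrow> tval e s < tval e t"
| "tv e (EqIdx a b) \<longleftrightarrow> False"
| "tv e (Prec a b) \<longleftrightarrow> False"
| "tv e (Tr a t) \<longleftrightarrow> False"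
| "tv e Fls \<longleftrightarrow> False"
| "tv e (Imp A B) \<longleftrightarrow> (tv e A \<longrightarrow> tv e B)"
| "tv e (And A B) \<longleftrightarrow> tv e A \<and> tv e B"
| "tv e (Or A B) \<longleftrightarrow> tv e A \<or> tv e B"
| "tv e (AllNum A) \<longleftrightarrow> (\<forall>n. tv (case_nat n e) A)"
| "tv e (ExNum A) \<longleftrightarrow> (\<exists>n. tv (case_nat n e) A)"
| "tv e (AllIdx A) \<longleftrightarrow> False"
| "tv e (ExIdx A) \<longleftrightarrow> False"

abbreviation BAll :: "nat \<Rightarrow> fm \<Rightarrow> fm" where
  "BAll i A \<equiv> AllNum (Imp (Less (NVar 0) (NVar (Suc i))) A)"

abbreviation BEx :: "nat \<Rightarrow> fm \<Rightarrow> fm" where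
  "BEx i A \<equiv> ExNum (And (Less (NVar 0) (NVar (Suc i))) A)"

text \<open>Bounds are variables rather than terms: a closing assignment turns them into numerals,
  ready for \<open>Q_Less_numeral\<close>.\<close>

inductive bounded :: "fm \<Rightarrow> bool" where
  bounded_EqNum: "bounded (EqNum s t)"
| bounded_Less: "bounded (Less s t)"
| bounded_Fls: "bounded Fls"
| bounded_Imp: "bounded A \<Longrightarrow> bounded B \<Longrightarrow> bounded (Imp A B)"
| bounded_And: "bounded A \<Longrightarrow> bounded B \<Longrightarrow> bounded (And A B)"
| bounded_BAll: "bounded A \<Longrightarrow> bounded (BAll i A)"
| bounded_BEx: "bounded A \<Longrightarrow> bounded (BEx i A)"

lemma wft_exists: "\<exists>m. wft m t"
proof (induction t)
  case (NVar i)
  show ?case by (rule exI[of _ "Suc i"]) simp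
next
  case (Plus s t)
  then obtain m n where "wft m s" "wft n t" by blast
  then show ?case by (intro exI[of _ "max m n"]) (auto intro: wft_mono[of m] wft_mono[of n])
next
  case (Times s t)
  then obtain m n where "wft m s" "wft n t" by blast
  then show ?case by (intro exI[of _ "max m n"]) (auto intro: wft_mono[of m] wft_mono[of n])
qed auto

lemma bounded_wff: "bounded A \<Longrightarrow> \<exists>m. wff m k A"
proof (induction rule: bounded.induct)
  case (bounded_EqNum s t)
  obtain m n where "wft m s" "wft n t" using wft_exists by blast
  then show ?case by (intro exI[of _ "max m n"]) (auto intro: wft_mono[of m] wft_mono[of n])
next
  case (bounded_Less s t)
  obtain m n where "wft m s" "wft n t" using wft_exists by blast
  then show ?case by (intro exI[of _ "max m n"]) (auto intro: wft_mono[of m] wft_mono[of n])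
next
  case (bounded_Imp A B)
  then obtain m n where "wff m k A" "wff n k B" by blast
  then show ?case by (intro exI[of _ "max m n"]) (auto intro: wff_mono[of m] wff_mono[of n])
next
  case (bounded_And A B)
  then obtain m n where "wff m k A" "wff n k B" by blast
  then show ?case by (intro exI[of _ "max m n"]) (auto intro: wff_mono[of m] wff_mono[of n])
next
  case (bounded_BAll A i)
  then obtain m where "wff m k A" by blast
  then show ?case by (intro exI[of _ "max m (Suc i)"]) (auto intro: wff_mono[of m])
next
  case (bounded_BEx A i)
  then obtain m where "wff m k A" by blast
  then show ?case by (intro exI[of _ "max m (Suc i)"]) (auto intro: wff_mono[of m])
qed auto

lemma bounded_fsubst_wff:
  "bounded A \<Longrightarrow> (\<And>i. wft m (\<sigma> i)) \<Longrightarrow> wff m k (fsubst \<sigma> (\<lambda>a. a) A)"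
  using bounded_wff[of A k] by (metis wff_fsubst)

section \<open>Robinson arithmetic decides bounded formulas\<close>

abbreviation nums :: "(nat \<Rightarrow> nat) \<Rightarrow> nat \<Rightarrow> nterm" where
  "nums e \<equiv> \<lambda>i. numeral_of (e i)"

lemma up_num_nums: "(up_num (nums e))(0 := numeral_of l) = nums (case_nat l e)"
  by (auto simp: fun_eq_iff up_num_def split: nat.split)

lemma inst_up_nums:
  "inst_num (numeral_of l) (fsubst (up_num (nums e)) (\<lambda>a. a) A) = fsubst (nums (case_nat l e)) (\<lambda>a. a) A"
proof -
  have "(\<lambda>i. tsubst (case_nat (numeral_of l) NVar) (up_num (nums e) i)) = nums (case_nat l e)"
    by (auto simp: fun_eq_iff up_num_def split: nat.split)
  then show ?thesis by (simp add: inst_num_def fsubst_compose)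
qed

lemma wft_up_nums [simp]: "wft (Suc m) (up_num (nums e) i)"
  by (cases i) simp_all

text \<open>Provability and refutability go through one induction because an implication reverses
  the sign of its premise. A quantifier bounded by a numeral splits into finitely many
  instances.\<close>

lemma Q_bounded_complete:
  assumes "bounded A" "Q_axioms \<subseteq> \<Gamma>"
  shows "(tv e A \<longrightarrow> derives m k \<Gamma> (fsubst (nums e) (\<lambda>a. a) A)) \<and>
    (\<not> tv e A \<longrightarrow> derives m k \<Gamma> (Neg (fsubst (nums e) (\<lambda>a. a) A)))"
  using assms
proof (induction arbitrary: m k \<Gamma> e rule: bounded.induct)
  case (bounded_EqNum s t)
  let ?s = "tsubst (nums e) s" and ?t = "tsubst (nums e) t"
  have ev: "derives m k \<Delta> (EqNum (tsubst (nums e) u) (numeral_of (tval e u)))"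
    if "Q_axioms \<subseteq> \<Delta>" for \<Delta> u
    using that by (rule Q_tval)
  show ?case
  proof (intro conjI impI)
    assume "tv e (EqNum s t)"
    then show "derives m k \<Gamma> (fsubst (nums e) (\<lambda>a. a) (EqNum s t))"
      using ev[OF bounded_EqNum, of s] EqNum_sym[OF ev[OF bounded_EqNum, of t]]
      by (auto intro: EqNum_trans)
  next
    assume ne: "\<not> tv e (EqNum s t)"
    let ?\<Delta> = "insert (EqNum ?s ?t) \<Gamma>"
    have Q: "Q_axioms \<subseteq> ?\<Delta>" using bounded_EqNum by blast
    have "derives m k ?\<Delta> (EqNum (numeral_of (tval e s)) (numeral_of (tval e t)))"
      by (intro EqNum_trans[OF EqNum_sym[OF ev[OF Q]] EqNum_trans[OF Assm_insert ev[OF Q]]]) simp_all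
    then show "derives m k \<Gamma> (Neg (fsubst (nums e) (\<lambda>a. a) (EqNum s t)))"
      using ne by (auto intro!: ImpI intro: ImpE[OF Q_numeral_neq[OF Q]])
  qed
next
  case (bounded_Less s t)
  let ?s = "tsubst (nums e) s" and ?t = "tsubst (nums e) t"
  have ev: "derives m k \<Delta> (EqNum (tsubst (nums e) u) (numeral_of (tval e u)))"
    if "Q_axioms \<subseteq> \<Delta>" for \<Delta> u
    using that by (rule Q_tval)
  show ?case
  proof (intro conjI impI)
    assume "tv e (Less s t)"
    then show "derives m k \<Gamma> (fsubst (nums e) (\<lambda>a. a) (Less s t))"
      by (auto intro!: EqNum_Less[OF EqNum_sym[OF ev] EqNum_sym[OF ev] Q_numeral_Less] bounded_Less)
  next
    assume ne: "\<not> tv e (Less s t)"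
    let ?\<Delta> = "insert (Less ?s ?t) \<Gamma>"
    have Q: "Q_axioms \<subseteq> ?\<Delta>" using bounded_Less by blast
    have "derives m k ?\<Delta> (Less (numeral_of (tval e s)) (numeral_of (tval e t)))"
      by (intro EqNum_Less[OF ev[OF Q] ev[OF Q] Assm_insert]) simp_all
    then show "derives m k \<Gamma> (Neg (fsubst (nums e) (\<lambda>a. a) (Less s t)))"
      using ne by (auto intro!: ImpI intro: ImpE[OF Q_numeral_not_Less[OF Q]])
  qed
next
  case bounded_Fls
  then show ?case by (auto intro!: ImpI Assm_insert)
next
  case (bounded_Imp A B)
  let ?A = "fsubst (nums e) (\<lambda>a. a) A" and ?B = "fsubst (nums e) (\<lambda>a. a) B"
  have w: "wff m k ?A" "wff m k ?B"
    using bounded_Imp by (simp_all add: bounded_fsubst_wff)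
  have IA: "tv e A \<Longrightarrow> derives m k \<Gamma> ?A" "\<not> tv e A \<Longrightarrow> derives m k \<Gamma> (Neg ?A)"
    and IB: "tv e B \<Longrightarrow> derives m k \<Gamma> ?B" "\<not> tv e B \<Longrightarrow> derives m k \<Gamma> (Neg ?B)"
    using bounded_Imp by blast+
  show ?case
  proof (intro conjI impI)
    assume "tv e (Imp A B)"
    then consider "\<not> tv e A" | "tv e B" by auto
    then show "derives m k \<Gamma> (fsubst (nums e) (\<lambda>a. a) (Imp A B))"
    proof cases
      case 1
      then show ?thesis using w IA by (auto intro!: ImpI intro: NegE[OF derives_insert Assm_insert])
    next
      case 2
      then show ?thesis using w IB by (auto intro!: ImpI intro: derives_insert)
    qed
  next
    assume "\<not> tv e (Imp A B)"
    then have "tv e A" "\<not> tv e B" by auto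
    then show "derives m k \<Gamma> (Neg (fsubst (nums e) (\<lambda>a. a) (Imp A B)))"
      using w ImpI[OF _ ImpE[OF derives_insert[OF IB(2)] ImpE[OF Assm_insert derives_insert[OF IA(1)]]]]
      by simp
  qed
next
  case (bounded_And A B)
  let ?A = "fsubst (nums e) (\<lambda>a. a) A" and ?B = "fsubst (nums e) (\<lambda>a. a) B"
  have w: "wff m k ?A" "wff m k ?B"
    using bounded_And by (simp_all add: bounded_fsubst_wff)
  have IA: "tv e A \<Longrightarrow> derives m k \<Gamma> ?A" "\<not> tv e A \<Longrightarrow> derives m k \<Gamma> (Neg ?A)"
    and IB: "tv e B \<Longrightarrow> derives m k \<Gamma> ?B" "\<not> tv e B \<Longrightarrow> derives m k \<Gamma> (Neg ?B)"
    using bounded_And by blast+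
  have "derives m k (insert (And ?A ?B) \<Gamma>) ?A" "derives m k (insert (And ?A ?B) \<Gamma>) ?B"
    using w by (auto intro: AndE1[OF Assm_insert] AndE2[OF Assm_insert])
  then show ?case
    using w IA IB by (auto intro!: AndI ImpI intro: ImpE[OF derives_insert])
next
  case (bounded_BAll A i)
  let ?A = "fsubst (up_num (nums e)) (\<lambda>a. a) A" and ?n = "numeral_of (e i)"
  let ?L = "Less (NVar 0) ?n"
  have wA: "wff (Suc m) k ?A" using bounded_BAll by (simp add: bounded_fsubst_wff)
  obtain m' where m': "wff m' k A" using bounded_wff bounded_BAll by blast
  have "derives m k \<Gamma> (AllNum (Imp ?L ?A))" if "tv e (BAll i A)"
  proof (intro AllNumI ImpI)
    let ?\<Delta> = "lift_num ` \<Gamma>"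
    have Q: "Q_axioms \<subseteq> ?\<Delta>" using bounded_BAll by (intro Q_lift)
    show "derives (Suc m) k (insert ?L ?\<Delta>) ?A"
    proof (rule one_ofE[OF Q_Less_numeral[OF Q] wA])
      fix l assume "l < e i"
      let ?\<Theta> = "insert (EqNum (NVar 0) (numeral_of l)) (insert ?L ?\<Delta>)"
      have "derives (Suc m) k ?\<Theta> (fsubst (nums (case_nat l e)) (\<lambda>a. a) A)"
        using bounded_BAll.IH[of ?\<Theta> "case_nat l e"] Q that \<open>l < e i\<close> by auto
      \<comment> \<open>Leibniz' law carries the closed instance at \<open>l\<close> back to the
        open matrix.\<close>
      then have "derives (Suc m) k ?\<Theta> (fsubst ((up_num (nums e))(0 := NVar 0)) (\<lambda>a. a) A)"
        by (intro fsubst_EqNum[OF EqNum_sym[OF Assm_insert] _ m']) (simp_all add: up_num_nums)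
      then show "derives (Suc m) k ?\<Theta> ?A"
        by (simp add: fun_upd_idem)
    qed simp_all
  qed simp
  moreover have "derives m k \<Gamma> (Neg (AllNum (Imp ?L ?A)))" if not_tv: "\<not> tv e (BAll i A)"
  proof (rule ImpI)
    let ?\<Delta> = "insert (AllNum (Imp ?L ?A)) \<Gamma>"
    have Q: "Q_axioms \<subseteq> ?\<Delta>" using bounded_BAll by blast
    obtain l where l: "l < e i" "\<not> tv (case_nat l e) A" using not_tv by auto
    have "derives m k ?\<Delta> (inst_num (numeral_of l) (Imp ?L ?A))"
      using wA by (intro AllNumE Assm_insert) simp_all
    then have "derives m k ?\<Delta> (Imp (Less (numeral_of l) ?n) (fsubst (nums (case_nat l e)) (\<lambda>a. a) A))"
      using inst_up_nums[of l e A] by (simp add: inst_num_def)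
    from ImpE[OF this Q_numeral_Less[OF Q l(1)]]
    show "derives m k ?\<Delta> Fls"
      using bounded_BAll.IH[OF Q, of "case_nat l e" m k] l by (auto intro: ImpE)
  qed (use wA in simp)
  ultimately show ?case by simp
next
  case (bounded_BEx A i)
  let ?A = "fsubst (up_num (nums e)) (\<lambda>a. a) A" and ?n = "numeral_of (e i)"
  let ?L = "Less (NVar 0) ?n"
  have wA: "wff (Suc m) k ?A" using bounded_BEx by (simp add: bounded_fsubst_wff)
  obtain m' where m': "wff m' k A" using bounded_wff bounded_BEx by blast
  have "derives m k \<Gamma> (ExNum (And ?L ?A))" if tv: "tv e (BEx i A)"
  proof -
    obtain l where l: "l < e i" "tv (case_nat l e) A" using tv by auto
    have "derives m k \<Gamma> (And (Less (numeral_of l) ?n) (fsubst (nums (case_nat l e)) (\<lambda>a. a) A))"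
      using bounded_BEx l by (intro AndI Q_numeral_Less) auto
    then have "derives m k \<Gamma> (inst_num (numeral_of l) (And ?L ?A))"
      using inst_up_nums[of l e A] by (simp add: inst_num_def)
    then show ?thesis
      using wA by (intro ExNumI) simp_all
  qed
  moreover have "derives m k \<Gamma> (Neg (ExNum (And ?L ?A)))" if "\<not> tv e (BEx i A)"
  proof (intro ImpI ExNumE[OF Assm_insert])
    let ?\<Delta> = "insert (And ?L ?A) (lift_num ` insert (ExNum (And ?L ?A)) \<Gamma>)"
    have Q: "Q_axioms \<subseteq> ?\<Delta>" using bounded_BEx by (intro Q_insert Q_lift)
    have "derives (Suc m) k ?\<Delta> ?L"
      using wA by (intro AndE1[OF Assm_insert]) simp
    then have "derives (Suc m) k ?\<Delta> (one_of (e i) (NVar 0))"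
      by (rule cut[OF _ _ Q_Less_numeral[OF Q]]) simp_all
    then show "derives (Suc m) k ?\<Delta> (lift_num Fls)"
    proof (rule one_ofE)
      fix l assume "l < e i"
      let ?\<Theta> = "insert (EqNum (NVar 0) (numeral_of l)) ?\<Delta>"
      \<comment> \<open>Here the open matrix is carried to the closed instance at \<open>l\<close>,
        which the induction hypothesis refutes.\<close>
      have "derives (Suc m) k ?\<Theta> (fsubst ((up_num (nums e))(0 := NVar 0)) (\<lambda>a. a) A)"
        using wA AndE2[OF Assm[of "And ?L ?A" ?\<Theta> "Suc m" k]] by (simp add: fun_upd_idem)
      then have "derives (Suc m) k ?\<Theta> (fsubst (nums (case_nat l e)) (\<lambda>a. a) A)"
        unfolding up_num_nums[symmetric]
        by (intro fsubst_EqNum[OF Assm_insert _ m']) simp_all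
      moreover have "derives (Suc m) k ?\<Theta> (Neg (fsubst (nums (case_nat l e)) (\<lambda>a. a) A))"
        using bounded_BEx.IH[of ?\<Theta> "case_nat l e"] Q that \<open>l < e i\<close> by auto
      ultimately show "derives (Suc m) k ?\<Theta> (lift_num Fls)" by (auto intro: ImpE)
    qed simp_all
  qed (use wA in simp_all)
  ultimately show ?case by simp
qed

section \<open>A bounded graph of the diagonal function\<close>

text \<open>Goedel's beta-function lemma: for a factorial \<open>a\<close> the moduli are pairwise
  coprime, and the Chinese remainder theorem supplies \<open>b\<close>.\<close>

lemma beta_exists: "\<exists>a b :: nat. \<forall>i\<le>n. b mod Suc (Suc i * a) = f i"
proof -
  \<comment> \<open>\<open>N\<close> exceeds \<open>n\<close>, so every difference of two positions
    divides \<open>fact N\<close>; it also exceeds every \<open>f i\<close>, so each value is below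
    its modulus.\<close>
  define N where "N = Suc n + (\<Sum>i\<le>n. f i)"
  define a :: nat where "a = fact N"
  have coprime: "coprime (Suc (Suc i * a)) (Suc (Suc j * a))" if "i < j" "j \<le> n" for i j
  proof (rule coprimeI)
    fix d assume d: "d dvd Suc (Suc i * a)" "d dvd Suc (Suc j * a)"
    have "Suc (Suc j * a) - Suc (Suc i * a) = (j - i) * a"
      using that by (simp add: diff_mult_distrib)
    then have "d dvd (j - i) * a" using d by (metis dvd_diff_nat)
    \<comment> \<open>Each modulus is 1 modulo \<open>a\<close>, so its divisors are coprime to
      \<open>a\<close>. Hence \<open>d\<close> divides \<open>j - i\<close>, which divides
      \<open>a\<close>, and \<open>d\<close> must be a unit.\<close>
    moreover have "coprime d a"
    proof (rule coprimeI)
      fix e assume "e dvd d" "e dvd a"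
      then have "e dvd Suc (Suc i * a)" "e dvd Suc i * a" using d by (auto intro: dvd_trans)
      then show "is_unit e" by (metis Suc_eq_plus1 dvd_add_right_iff)
    qed
    ultimately have "d dvd j - i" by (simp add: coprime_dvd_mult_left_iff)
    moreover have "j - i dvd a"
      unfolding a_def using that by (intro dvd_fact) (auto simp: N_def)
    ultimately have "d dvd Suc i * a" by (meson dvd_mult dvd_trans)
    then show "is_unit d" using d by (metis Suc_eq_plus1 dvd_add_right_iff)
  qed
  have "coprime (Suc (Suc i * a)) (Suc (Suc j * a))" if "i \<le> n" "j \<le> n" "i \<noteq> j" for i j
    using that coprime[of i j] coprime[of j i] by (cases "i < j") (auto simp: coprime_commute)
  then have "\<exists>b. \<forall>i\<in>{..n}. [b = f i] (mod Suc (Suc i * a))"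
    by (intro chinese_remainder_nat) auto
  then obtain b where b: "\<And>i. i \<le> n \<Longrightarrow> [b = f i] (mod Suc (Suc i * a))" by auto
  have "b mod Suc (Suc i * a) = f i" if "i \<le> n" for i
  proof -
    have "f i \<le> (\<Sum>i\<le>n. f i)" using that by (intro member_le_sum) auto
    also have "\<dots> \<le> a" unfolding a_def using fact_ge_self[of N] by (simp add: N_def)
    finally have "f i < Suc (Suc i * a)" by simp
    then show ?thesis using b[OF that] by (simp add: cong_def)
  qed
  then show ?thesis by blast
qed

section \<open>Bounded formulas for remainders, pairs and the diagonal function\<close>

lemma tval_lift [simp]: "tval (case_nat n e) (lift_t t) = tval e t"
  by (induction t) simp_all

lemma tval_numeral [simp]: "tval e (numeral_of n) = n"
  by (induction n) simp_all

text \<open>\<open>v = b mod (1 + (i + 1) a)\<close>, Goedel's \<open>\<beta>\<close>-function, where the bound \<open>w\<close> exceeds \<open>b\<close>.\<close>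

definition beta_fm :: "nat \<Rightarrow> nterm \<Rightarrow> nterm \<Rightarrow> nterm \<Rightarrow> nterm \<Rightarrow> fm" where
  "beta_fm w a b i v = And (Less v (Succ (Times (Succ i) a)))
    (BEx w (EqNum (lift_t b) (Plus (Times (NVar 0) (Succ (Times (Succ (lift_t i)) (lift_t a)))) (lift_t v))))"

text \<open>The Cantor pairing \<open>triangle (s + t) + s\<close>, doubled on both sides to avoid a
  division.\<close>

definition pair_fm :: "nterm \<Rightarrow> nterm \<Rightarrow> nterm \<Rightarrow> fm" where
  "pair_fm s t r = EqNum (Plus r r) (Plus (Times (Plus s t) (Succ (Plus s t))) (Plus s s))"

lemma tv_beta_fm [simp]:
  assumes "tval e b < e w"
  shows "tv e (beta_fm w a b i v) \<longleftrightarrow> tval e v = tval e b mod Suc (Suc (tval e i) * tval e a)"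
proof -
  define M where "M = Suc (Suc (tval e i) * tval e a)"
  have "tv e (beta_fm w a b i v) \<longleftrightarrow> tval e v < M \<and> (\<exists>q<e w. tval e b = q * M + tval e v)"
    by (simp add: beta_fm_def M_def)
  also have "\<dots> \<longleftrightarrow> tval e v = tval e b mod M"
  proof
    assume "tval e v < M \<and> (\<exists>q<e w. tval e b = q * M + tval e v)"
    then show "tval e v = tval e b mod M" by auto
  next
    assume v: "tval e v = tval e b mod M"
    \<comment> \<open>The quotient is at most \<open>b\<close>, so bounding it by \<open>w\<close>
      loses no witness.\<close>
    have "tval e b div M < e w" using assms by (meson div_le_dividend le_less_trans)
    moreover have "tval e b = tval e b div M * M + tval e v" using v by simp
    moreover have "tval e v < M" using v by (simp add: M_def)
    ultimately show "tval e v < M \<and> (\<exists>q<e w. tval e b = q * M + tval e v)" by blast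
  qed
  finally show ?thesis by (simp add: M_def)
qed

lemma tv_pair_fm [simp]:
  "tv e (pair_fm s t r) \<longleftrightarrow> tval e r = prod_encode (tval e s, tval e t)"
proof -
  have "2 * triangle n = n * Suc n" for n
    by (induction n) simp_all
  then have "2 * prod_encode (tval e s, tval e t)
      = (tval e s + tval e t) * Suc (tval e s + tval e t) + 2 * tval e s"
    by (simp only: prod_encode_def prod.case distrib_left)
  then show ?thesis by (auto simp: pair_fm_def)
qed

lemma bounded_beta_fm [simp]: "bounded (beta_fm w a b i v)"
  by (simp add: beta_fm_def bounded.intros)

lemma bounded_pair_fm [simp]: "bounded (pair_fm s t r)"
  by (simp add: pair_fm_def bounded.intros)

lemma wff_beta_fm [simp]:
  "w < m \<Longrightarrow> wft m a \<Longrightarrow> wft m b \<Longrightarrow> wft m i \<Longrightarrow> wft m v \<Longrightarrow> wff m k (beta_fm w a b i v)"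
  by (simp add: beta_fm_def)

lemma wff_pair_fm [simp]: "wft m s \<Longrightarrow> wft m t \<Longrightarrow> wft m r \<Longrightarrow> wff m k (pair_fm s t r)"
  by (simp add: pair_fm_def)

text \<open>10, 7 and the first 0 are the tags of \<open>ExNum\<close>, \<open>And\<close> and
  \<open>EqNum\<close>; the second 0 is the code of \<open>NVar 0\<close>. Prefixing an equation
  replaces substitution into the formula, so only codes of numerals have to be computed by
  recursion.\<close>

definition diag :: "nat \<Rightarrow> nat" where
  "diag n = prod_encode (10, prod_encode (7, prod_encode
    (prod_encode (0, prod_encode (0, tcode (numeral_of n))), n)))"

lemma gcode_diag: "gcode (ExNum (And (EqNum (NVar 0) (numeral_of (gcode A))) A)) = diag (gcode A)"
  by (simp add: diag_def prod_encode_def)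

text \<open>\<open>y = diag x\<close>, as witnessed below \<open>w\<close>: some \<open>a\<close>, \<open>b\<close> code the sequence of the codes of the
  numerals up to \<open>x\<close>. All arguments are variable indices.\<close>

definition trace_fm :: "nat \<Rightarrow> nat \<Rightarrow> nat \<Rightarrow> fm" where
  "trace_fm y w x = BEx w (BEx (w + 1)
    (And (BEx (w + 2) (And (beta_fm (w + 3) (NVar 2) (NVar 1) Zero (NVar 0))
        (pair_fm (numeral_of 1) Zero (NVar 0))))
    (And (BAll (x + 2) (BEx (w + 3) (BEx (w + 4)
        (And (beta_fm (w + 5) (NVar 4) (NVar 3) (NVar 2) (NVar 1))
        (And (beta_fm (w + 5) (NVar 4) (NVar 3) (Succ (NVar 2)) (NVar 0))
          (pair_fm (numeral_of 2) (NVar 1) (NVar 0)))))))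
      (BEx (w + 2) (And (beta_fm (w + 3) (NVar 2) (NVar 1) (NVar (x + 3)) (NVar 0))
        (BEx (w + 3) (And (pair_fm Zero (NVar 1) (NVar 0))
        (BEx (w + 4) (And (pair_fm Zero (NVar 1) (NVar 0))
        (BEx (w + 5) (And (pair_fm (NVar 1) (NVar (x + 6)) (NVar 0))
        (BEx (w + 6) (And (pair_fm (numeral_of 7) (NVar 1) (NVar 0))
          (pair_fm (numeral_of 10) (NVar 0) (NVar (y + 7))))))))))))))))"

text \<open>The meaning of \<open>trace_fm\<close> in the natural numbers, kept in the same shape so
  that simplification matches the two. The coded sequence starts at the code of \<open>Zero\<close>
  and prefixes the tag of \<open>Succ\<close>; the chain \<open>p\<close>, \<open>q\<close>,
  \<open>r\<close>, \<open>s\<close> rebuilds \<open>diag x\<close> from the inside out.\<close>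

definition trace :: "nat \<Rightarrow> nat \<Rightarrow> nat \<Rightarrow> bool" where
  "trace y w x \<longleftrightarrow> (\<exists>a<w. \<exists>b<w.
    (\<exists>v<w. v = b mod Suc a \<and> v = prod_encode (1, 0)) \<and>
    (\<forall>i<x. \<exists>v<w. \<exists>v'<w. v = b mod Suc (Suc i * a) \<and> v' = b mod Suc (Suc (Suc i) * a) \<and>
      v' = prod_encode (2, v)) \<and>
    (\<exists>u<w. u = b mod Suc (Suc x * a) \<and> (\<exists>p<w. p = prod_encode (0, u) \<and>
      (\<exists>q<w. q = prod_encode (0, p) \<and> (\<exists>r<w. r = prod_encode (q, x) \<and>
      (\<exists>s<w. s = prod_encode (7, r) \<and> y = prod_encode (10, s)))))))"

lemma case_nat_arith [simp]:
  "case_nat z f (n + 1) = f n"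
  "case_nat z f (numeral k) = f (pred_numeral k)"
  "case_nat z f (n + numeral k) = f (n + pred_numeral k)"
  by (simp_all add: numeral_eq_Suc)

lemma up_num_arith:
  "up_num \<sigma> (n + 1) = lift_t (\<sigma> n)"
  "up_num \<sigma> (numeral k) = lift_t (\<sigma> (pred_numeral k))"
  "up_num \<sigma> (n + numeral k) = lift_t (\<sigma> (n + pred_numeral k))"
  "up_num \<sigma> (numeral k + n) = lift_t (\<sigma> (pred_numeral k + n))"
  by (simp_all add: numeral_eq_Suc)

lemma tv_trace_fm: "tv e (trace_fm y w x) \<longleftrightarrow> trace (e y) (e w) (e x)"
  unfolding trace_fm_def trace_def by (simp cong: conj_cong)

lemma bounded_trace_fm: "bounded (trace_fm y w x)"
  unfolding trace_fm_def by (intro bounded.intros bounded_beta_fm bounded_pair_fm)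

lemma wff_trace_fm: "y < m \<Longrightarrow> w < m \<Longrightarrow> x < m \<Longrightarrow> wff m k (trace_fm y w x)"
  by (simp add: trace_fm_def)

text \<open>\<open>fsubst_cong\<close> would ask for agreement on all variables below a bound; here
  the substitutions may differ on variables between the three arguments.\<close>

lemma trace_fm_cong:
  assumes "\<sigma> y = \<tau> y" "\<sigma> w = \<tau> w" "\<sigma> x = \<tau> x"
  shows "fsubst \<sigma> \<rho> (trace_fm y w x) = fsubst \<tau> \<rho> (trace_fm y w x)"
  by (simp add: trace_fm_def beta_fm_def pair_fm_def up_num_arith assms)

text \<open>Whatever \<open>a\<close> and \<open>b\<close> are, the first entry and the step clause
  force entry \<open>i\<close> to be the code of the numeral of \<open>i\<close>.\<close>

lemma trace_sound:
  assumes "trace y w x"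
  shows "y = diag x"
proof -
  obtain a b where base: "b mod Suc a = prod_encode (1, 0)"
    and step: "\<And>i. i < x \<Longrightarrow> b mod Suc (Suc (Suc i) * a) = prod_encode (2, b mod Suc (Suc i * a))"
    and y: "y = prod_encode (10, prod_encode (7, prod_encode
      (prod_encode (0, prod_encode (0, b mod Suc (Suc x * a))), x)))"
    using assms unfolding trace_def by metis
  have "i \<le> x \<Longrightarrow> b mod Suc (Suc i * a) = tcode (numeral_of i)" for i
  proof (induction i)
    case 0
    then show ?case using base by simp
  next
    case (Suc i)
    then show ?case using step[of i] by simp
  qed
  then show ?thesis using y by (simp add: diag_def)
qed

lemma trace_complete: "\<exists>w>diag x. trace (diag x) w x"
proof -
  obtain a b where ab: "\<And>i. i \<le> x \<Longrightarrow> b mod Suc (Suc i * a) = tcode (numeral_of i)"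
    using beta_exists[of x "\<lambda>i. tcode (numeral_of i)"] by blast
  \<comment> \<open>The entries are remainders of \<open>b\<close> and the pairs \<open>p\<close>,
    \<open>q\<close>, \<open>r\<close>, \<open>s\<close> are at most \<open>diag x\<close>, so this
    \<open>w\<close> bounds every witness.\<close>
  define w where "w = Suc (a + b + diag x)"
  have g: "tcode (numeral_of i) < w" if "i \<le> x" for i
    using ab[OF that] mod_less_eq_dividend[of b "Suc (Suc i * a)"] by (simp add: w_def)
  define p where "p = prod_encode (0, tcode (numeral_of x))"
  define q where "q = prod_encode (0, p)"
  define r where "r = prod_encode (q, x)"
  define s where "s = prod_encode (7, r)"
  have d: "diag x = prod_encode (10, s)" by (simp add: diag_def p_def q_def r_def s_def)
  have "p \<le> q" "q \<le> r" "r \<le> s" "s \<le> diag x"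
    unfolding d unfolding q_def r_def s_def by (rule le_prod_encode_1 le_prod_encode_2)+
  moreover have "diag x < w" by (simp add: w_def)
  ultimately have lt: "p < w" "q < w" "r < w" "s < w" by auto
  have 1: "\<exists>v<w. v = b mod Suc a \<and> v = prod_encode (1, 0)"
    using g[of 0] ab[of 0] by auto
  have 2: "\<exists>v<w. \<exists>v'<w. v = b mod Suc (Suc i * a) \<and> v' = b mod Suc (Suc (Suc i) * a) \<and>
      v' = prod_encode (2, v)" if "i < x" for i
  proof -
    have "tcode (numeral_of (Suc i)) = prod_encode (2, tcode (numeral_of i))" by simp
    then show ?thesis
      using that g[of i] g[of "Suc i"] ab[of i] ab[of "Suc i"] by (metis Suc_leI less_imp_le)
  qed
  have 3: "tcode (numeral_of x) < w" "tcode (numeral_of x) = b mod Suc (Suc x * a)"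
    using g[of x] ab[of x] by simp_all
  have ab_less: "a < w" "b < w" by (simp_all add: w_def)
  have "trace (diag x) w x"
    unfolding trace_def
  proof (rule exI[of _ a], intro conjI ab_less, rule exI[of _ b], intro conjI ab_less 1 allI impI 2)
    show "\<exists>u<w. u = b mod Suc (Suc x * a) \<and> (\<exists>p<w. p = prod_encode (0, u) \<and>
      (\<exists>q<w. q = prod_encode (0, p) \<and> (\<exists>r<w. r = prod_encode (q, x) \<and>
      (\<exists>s<w. s = prod_encode (7, r) \<and> diag x = prod_encode (10, s)))))"
      using 3(1) lt d unfolding 3(2)[symmetric] s_def r_def q_def p_def by simp
  qed assumption
  then show ?thesis using \<open>diag x < w\<close> by blast
qed

section \<open>The diagonal lemma\<close>

text \<open>The variables are \<open>y = 0\<close>, \<open>w = 1\<close>, \<open>x = 2\<close>. Without induction, a nonstandard \<open>w\<close> might witness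
  a wrong value \<open>y\<close>; minimality of \<open>w\<close> confines it to the standard numbers.\<close>

definition least_trace_fm :: fm where
  "least_trace_fm = And (And (Less (NVar 0) (NVar 1)) (trace_fm 0 1 2))
    (BAll 1 (BAll 0 (Neg (trace_fm 0 1 4))))"

lemma bounded_least_trace_fm: "bounded least_trace_fm"
  unfolding least_trace_fm_def by (intro bounded.intros bounded_trace_fm)

lemma wff_least_trace_fm: "3 \<le> m \<Longrightarrow> wff m k least_trace_fm"
  by (simp add: least_trace_fm_def wff_trace_fm)

lemma tv_least_trace_fm:
  "tv e least_trace_fm \<longleftrightarrow> e 0 < e 1 \<and> trace (e 0) (e 1) (e 2) \<and>
    (\<forall>w<e 1. \<forall>y<w. \<not> trace y w (e 2))"
  by (simp add: least_trace_fm_def tv_trace_fm)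

text \<open>The least \<open>w\<close> for the value \<open>diag x\<close> is least for all values,
  because by \<open>trace_sound\<close> no other value has a trace.\<close>

lemma least_trace_exists:
  "\<exists>w>diag x. trace (diag x) w x \<and> (\<forall>w'<w. \<forall>y<w'. \<not> trace y w' x)"
proof -
  let ?P = "\<lambda>w. diag x < w \<and> trace (diag x) w x"
  have "?P (LEAST w. ?P w)" using trace_complete[of x] by (rule LeastI_ex)
  moreover have "\<not> trace y w' x" if "w' < (LEAST w. ?P w)" "y < w'" for w' y
    using that not_less_Least[of w' ?P] trace_sound[of y w' x] by auto
  ultimately show ?thesis by blast
qed

text \<open>Expresses that \<open>B\<close> holds of \<open>diag x\<close>, with \<open>x\<close> as
  the free variable; the outer quantifier binds \<open>w\<close> and the inner one
  \<open>y\<close>.\<close>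

definition diag_fm :: "fm \<Rightarrow> fm" where
  "diag_fm B = ExNum (ExNum (And least_trace_fm B))"

text \<open>When \<open>n\<close> is the code of \<open>diag_fm B\<close>, this formula has the code
  \<open>diag n\<close> and is the fixed point of \<open>B\<close>. The two parameters are
  independent because relativisation alters \<open>B\<close> but not the number.\<close>

definition fixpoint_fm :: "nat \<Rightarrow> fm \<Rightarrow> fm" where
  "fixpoint_fm n B = ExNum (And (EqNum (NVar 0) (numeral_of n)) (diag_fm B))"

lemma wff_diag_fm: "wff 1 k B \<Longrightarrow> wff (Suc m) k (diag_fm B)"
  using wff_mono[of 1 k B "Suc (Suc (Suc m))" k] by (simp add: diag_fm_def wff_least_trace_fm)

lemma wff_fixpoint_fm: "wff 1 k B \<Longrightarrow> wff m k (fixpoint_fm n B)"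
  by (simp add: fixpoint_fm_def wff_diag_fm)

lemma inst_num_closed:
  assumes "wff 1 k B"
  shows "wff 0 k (inst_num (numeral_of n) B)" "lift_num (inst_num (numeral_of n) B) = inst_num (numeral_of n) B"
proof -
  show *: "wff 0 k (inst_num (numeral_of n) B)"
    unfolding inst_num_def using assms by (rule wff_fsubst) auto
  show "lift_num (inst_num (numeral_of n) B) = inst_num (numeral_of n) B"
    using fsubst_cong[OF *, of "\<lambda>i. NVar (Suc i)" NVar "\<lambda>a. a" "\<lambda>a. a"] by (simp add: lift_num_def)
qed

text \<open>\<open>x\<close>, \<open>w\<close> and \<open>y\<close> receive standard values for
  which the bounded part is true, hence provable.\<close>

lemma fixpoint_fmI:
  assumes Q: "Q_axioms \<subseteq> \<Gamma>" and B: "wff 1 k B"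
    and der: "derives m k \<Gamma> (inst_num (numeral_of (diag n)) B)"
  shows "derives m k \<Gamma> (fixpoint_fm n B)"
proof -
  obtain w where w: "diag n < w" "trace (diag n) w n" "\<forall>w'<w. \<forall>y<w'. \<not> trace y w' n"
    using least_trace_exists[of n] by blast
  define e where "e = case_nat (diag n) (case_nat w (\<lambda>_. n))"
  \<comment> \<open>Instantiating \<open>x\<close>, \<open>w\<close> and \<open>y\<close> in turn
    agrees with the assignment \<open>e\<close> on the three variables that can occur.\<close>
  have sub: "fsubst (case_nat (numeral_of (diag n)) NVar) (\<lambda>a. a)
      (fsubst (up_num (case_nat (numeral_of w) NVar)) (\<lambda>a. a)
      (fsubst (up_num (up_num (case_nat (numeral_of n) NVar))) (\<lambda>a. a) A)) = fsubst (nums e) (\<lambda>a. a) A"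
    if "wff 3 k A" for A
    unfolding fsubst_compose using that
    by (rule fsubst_cong) (auto simp: e_def less_Suc_eq numeral_3_eq_3)
  have "derives m k \<Gamma> (fsubst (nums e) (\<lambda>a. a) least_trace_fm)"
    using Q_bounded_complete[OF bounded_least_trace_fm Q] w
    by (simp add: tv_least_trace_fm e_def)
  moreover have "fsubst (nums e) (\<lambda>a. a) B = inst_num (numeral_of (diag n)) B"
    unfolding inst_num_def using B by (rule fsubst_cong) (auto simp: e_def)
  moreover have w3: "wff 3 k B" using B by (rule wff_mono) simp_all
  ultimately have "derives m k \<Gamma> (inst_num (numeral_of (diag n))
      (fsubst (up_num (case_nat (numeral_of w) NVar)) (\<lambda>a. a)
      (fsubst (up_num (up_num (case_nat (numeral_of n) NVar))) (\<lambda>a. a) (And least_trace_fm B))))"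
    using der by (simp add: inst_num_def sub wff_least_trace_fm AndI)
  then have "derives m k \<Gamma> (ExNum (fsubst (up_num (case_nat (numeral_of w) NVar)) (\<lambda>a. a)
      (fsubst (up_num (up_num (case_nat (numeral_of n) NVar))) (\<lambda>a. a) (And least_trace_fm B))))"
  proof (rule ExNumI[rotated 2])
    show "wff (Suc m) k (fsubst (up_num (case_nat (numeral_of w) NVar)) (\<lambda>a. a)
        (fsubst (up_num (up_num (case_nat (numeral_of n) NVar))) (\<lambda>a. a) (And least_trace_fm B)))"
      unfolding fsubst_compose
      by (rule wff_fsubst[of 3 k]) (use w3 in \<open>auto simp: wff_least_trace_fm less_Suc_eq numeral_3_eq_3\<close>)
  qed simp
  then have "derives m k \<Gamma> (ExNum (ExNum
      (fsubst (up_num (up_num (case_nat (numeral_of n) NVar))) (\<lambda>a. a) (And least_trace_fm B))))"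
  proof (intro ExNumI[where t = "numeral_of w" and A = "ExNum _"])
    have "wff (Suc (Suc m)) k (fsubst (up_num (up_num (case_nat (numeral_of n) NVar))) (\<lambda>a. a) (And least_trace_fm B))"
      by (rule wff_fsubst[of 3 k]) (use w3 in \<open>auto simp: wff_least_trace_fm less_Suc_eq numeral_3_eq_3\<close>)
    then show "wff (Suc m) k (ExNum
        (fsubst (up_num (up_num (case_nat (numeral_of n) NVar))) (\<lambda>a. a) (And least_trace_fm B)))"
      by (simp only: wff.simps)
  qed (simp_all add: inst_num_def)
  then have "derives m k \<Gamma> (inst_num (numeral_of n) (diag_fm B))"
    by (simp add: inst_num_def diag_fm_def)
  then show ?thesis
    unfolding fixpoint_fm_def using wff_diag_fm[OF B]
    by (intro ExNumI[where t = "numeral_of n"]) (simp_all add: inst_num_def AndI EqNumRefl)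
qed

text \<open>\<open>w\<close> and \<open>y\<close> are variables and may denote nonstandard numbers.
  Comparing \<open>w\<close> with the least standard bound leaves numerical cases up to that bound;
  beyond it, the minimality clause fails.\<close>

lemma least_trace_unique:
  assumes Q: "Q_axioms \<subseteq> \<Gamma>" and B: "wff 1 k B" and m: "3 \<le> m"
    and der: "derives m k \<Gamma> least_trace_fm" "derives m k \<Gamma> B" "derives m k \<Gamma> (EqNum (NVar 2) (numeral_of n))"
  shows "derives m k \<Gamma> (inst_num (numeral_of (diag n)) B)" (is "derives m k \<Gamma> ?C")
proof -
  obtain w where w: "diag n < w" "trace (diag n) w n" "\<forall>w'<w. \<forall>y<w'. \<not> trace y w' n"
    using least_trace_exists[of n] by blast
  have C: "wff m k ?C" using inst_num_closed(1)[OF B] by (rule wff_mono) simp_all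
  let ?\<sigma> = "NVar(2 := numeral_of n)"
  have w3: "wff 3 k least_trace_fm" by (simp add: wff_least_trace_fm)
  have L1: "derives m k \<Gamma> (fsubst ?\<sigma> (\<lambda>a. a) least_trace_fm)"
    using fsubst_EqNum[OF der(3) _ w3, of NVar 2] der(1) m by (simp add: fun_upd_idem)
  \<comment> \<open>Once \<open>w\<close> is a numeral, \<open>y < w\<close> makes \<open>y\<close>
    a numeral too. The instance of \<open>least_trace_fm\<close> is then decided: if false, it
    contradicts the hypothesis; if true, \<open>trace_sound\<close> identifies
    \<open>y\<close>.\<close>
  have eq: "derives m k (insert (EqNum (NVar 1) (numeral_of i)) \<Gamma>) ?C" for i
  proof -
    let ?\<Delta> = "insert (EqNum (NVar 1) (numeral_of i)) \<Gamma>"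
    let ?\<tau> = "?\<sigma>(1 := numeral_of i)"
    have L2: "derives m k ?\<Delta> (fsubst ?\<tau> (\<lambda>a. a) least_trace_fm)"
    proof (rule fsubst_EqNum[OF Assm_insert _ w3])
      show "derives m k ?\<Delta> (fsubst (?\<sigma>(1 := NVar 1)) (\<lambda>a. a) least_trace_fm)"
        using derives_insert[OF L1] by (simp add: fun_upd_idem)
    qed (use m in auto)
    have "derives m k ?\<Delta> (Less (NVar 0) (numeral_of i))"
      using AndE1[OF AndE1[OF L2[unfolded least_trace_fm_def fsubst.simps]]] by simp
    then have "derives m k ?\<Delta> (one_of i (NVar 0))"
      by (rule cut[OF _ _ Q_Less_numeral]) (use m Q in auto)
    then show ?thesis
    proof (rule one_ofE[OF _ C])
      fix j assume "j < i"
      let ?\<Theta> = "insert (EqNum (NVar 0) (numeral_of j)) ?\<Delta>"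
      define e where "e = case_nat j (case_nat i (\<lambda>_. n))"
      have Q': "Q_axioms \<subseteq> ?\<Theta>" using Q by blast
      have "derives m k ?\<Theta> (fsubst (?\<tau>(0 := numeral_of j)) (\<lambda>a. a) least_trace_fm)"
      proof (rule fsubst_EqNum[OF Assm_insert _ w3])
        show "derives m k ?\<Theta> (fsubst (?\<tau>(0 := NVar 0)) (\<lambda>a. a) least_trace_fm)"
          using derives_insert[OF L2] by (simp add: fun_upd_idem)
      qed (use m in auto)
      moreover have "fsubst (?\<tau>(0 := numeral_of j)) (\<lambda>a. a) least_trace_fm
          = fsubst (nums e) (\<lambda>a. a) least_trace_fm"
        using w3 by (rule fsubst_cong) (auto simp: e_def less_Suc_eq numeral_3_eq_3 numeral_2_eq_2)
      ultimately have L3: "derives m k ?\<Theta> (fsubst (nums e) (\<lambda>a. a) least_trace_fm)" by simp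
      show "derives m k ?\<Theta> ?C"
      proof (cases "tv e least_trace_fm")
        case True
        then have j: "j = diag n"
          using trace_sound by (auto simp: tv_least_trace_fm e_def)
        have "derives m k ?\<Theta> (fsubst (NVar(0 := numeral_of j)) (\<lambda>a. a) B)"
        proof (rule fsubst_EqNum[OF Assm_insert _ B])
          show "derives m k ?\<Theta> (fsubst (NVar(0 := NVar 0)) (\<lambda>a. a) B)"
            using derives_insert[OF derives_insert[OF der(2)]] by (simp add: fun_upd_idem)
        qed (use m in auto)
        moreover have "fsubst (NVar(0 := numeral_of j)) (\<lambda>a. a) B = ?C"
          unfolding inst_num_def j using B by (rule fsubst_cong) auto
        ultimately show ?thesis by simp
      next
        case False
        then have "derives m k ?\<Theta> (Neg (fsubst (nums e) (\<lambda>a. a) least_trace_fm))"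
          using Q_bounded_complete[OF bounded_least_trace_fm Q'] by blast
        then show ?thesis using L3 C by (rule NegE)
      qed
    qed (use m in simp)
  qed
  have less: "derives m k (insert (Less (NVar 1) (numeral_of w)) \<Gamma>) ?C"
  proof (rule one_ofE[OF Q_Less_numeral[OF Q] C])
    fix i
    show "derives m k (insert (EqNum (NVar 1) (numeral_of i)) (insert (Less (NVar 1) (numeral_of w)) \<Gamma>)) ?C"
      using eq[of i] by (rule derives_mono) blast
  qed (use m in simp_all)
  \<comment> \<open>The minimality clause, instantiated at the standard \<open>w\<close> and at
    \<open>diag n\<close>, denies a trace that Robinson arithmetic proves.\<close>
  have greater: "derives m k (insert (Less (numeral_of w) (NVar 1)) \<Gamma>) ?C" (is "derives m k ?\<Delta> ?C")
  proof -
    have Q': "Q_axioms \<subseteq> ?\<Delta>" using Q by blast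
    define e where "e = case_nat (diag n) (case_nat w (\<lambda>_. n))"
    \<comment> \<open>Under the two bounded quantifiers, \<open>y\<close>, \<open>w\<close>,
      \<open>x\<close> of the context have become 2, 3, 4.\<close>
    let ?K = "trace_fm 0 1 4"
    have "derives m k ?\<Delta> (fsubst ?\<sigma> (\<lambda>a. a) (BAll 1 (BAll 0 (Neg ?K))))"
      using derives_insert[OF AndE2[OF L1[unfolded least_trace_fm_def fsubst.simps]]] by simp
    then have "derives m k ?\<Delta> (AllNum (fsubst (up_num ?\<sigma>) (\<lambda>a. a)
        (Imp (Less (NVar 0) (NVar 2)) (BAll 0 (Neg ?K)))))"
      by (simp add: numeral_2_eq_2)
    note inst1 = AllNumE[OF wft_numeral this, unfolded inst_num_def fsubst_compose, of w]
    define \<sigma>\<^sub>1 where "\<sigma>\<^sub>1 = (\<lambda>i. tsubst (case_nat (numeral_of w) NVar) (up_num ?\<sigma> i))"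
    have \<sigma>\<^sub>1: "\<sigma>\<^sub>1 0 = numeral_of w" "\<sigma>\<^sub>1 2 = NVar 1" "\<sigma>\<^sub>1 3 = numeral_of n"
      by (simp_all add: \<sigma>\<^sub>1_def up_num_arith)
    have "derives m k ?\<Delta> (Imp (Less (numeral_of w) (NVar 1)) (fsubst \<sigma>\<^sub>1 (\<lambda>a. a) (BAll 0 (Neg ?K))))"
      using inst1 \<sigma>\<^sub>1 unfolding \<sigma>\<^sub>1_def[symmetric] by simp
    then have "derives m k ?\<Delta> (fsubst \<sigma>\<^sub>1 (\<lambda>a. a) (BAll 0 (Neg ?K)))"
      by (rule ImpE) (use m in \<open>simp add: Assm_insert\<close>)
    then have "derives m k ?\<Delta> (AllNum (fsubst (up_num \<sigma>\<^sub>1) (\<lambda>a. a) (Imp (Less (NVar 0) (NVar 1)) (Neg ?K))))"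
      by simp
    note inst2 = AllNumE[OF wft_numeral this, unfolded inst_num_def fsubst_compose, of "diag n"]
    define \<sigma>\<^sub>2 where "\<sigma>\<^sub>2 = (\<lambda>i. tsubst (case_nat (numeral_of (diag n)) NVar) (up_num \<sigma>\<^sub>1 i))"
    have \<sigma>\<^sub>2: "\<sigma>\<^sub>2 0 = nums e 0" "\<sigma>\<^sub>2 1 = nums e 1" "\<sigma>\<^sub>2 4 = nums e 4"
      using \<sigma>\<^sub>1 by (simp_all add: \<sigma>\<^sub>2_def up_num_arith e_def)
    have "derives m k ?\<Delta> (Imp (Less (numeral_of (diag n)) (numeral_of w)) (fsubst \<sigma>\<^sub>2 (\<lambda>a. a) (Neg ?K)))"
      using inst2 \<sigma>\<^sub>2 unfolding \<sigma>\<^sub>2_def[symmetric] by (simp add: e_def)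
    from ImpE[OF this Q_numeral_Less[OF Q' w(1)]]
    have "derives m k ?\<Delta> (fsubst (nums e) (\<lambda>a. a) (Neg ?K))"
      using trace_fm_cong[where \<sigma> = \<sigma>\<^sub>2 and \<tau> = "nums e", OF \<sigma>\<^sub>2] by simp
    moreover have "derives m k ?\<Delta> (fsubst (nums e) (\<lambda>a. a) ?K)"
      using Q_bounded_complete[OF bounded_trace_fm Q', of e 0 1 4] w by (simp add: tv_trace_fm e_def)
    ultimately show ?thesis using C by (auto intro: NegE)
  qed
  show ?thesis
  proof (rule OrE[OF Q_trichotomy[OF Q, of m "NVar 1" k w] less])
    show "derives m k (insert (Or (EqNum (NVar 1) (numeral_of w)) (Less (numeral_of w) (NVar 1))) \<Gamma>) ?C"
      by (rule OrE[OF Assm_insert])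
        (use m in \<open>auto intro: derives_mono[OF eq[of w]] derives_mono[OF greater]\<close>)
  qed (use m in simp)
qed

lemma fixpoint_fmE:
  assumes Q: "Q_axioms \<subseteq> \<Gamma>" and B: "wff 1 k B" and der: "derives m k \<Gamma> (fixpoint_fm n B)"
  shows "derives m k \<Gamma> (inst_num (numeral_of (diag n)) B)" (is "derives m k \<Gamma> ?C")
proof -
  note lift_C = inst_num_closed(2)[OF B]
  let ?E = "And (EqNum (NVar 0) (numeral_of n)) (diag_fm B)"
  let ?L = "And least_trace_fm B"
  let ?\<Gamma>1 = "insert ?E (lift_num ` \<Gamma>)"
  let ?\<Gamma>2 = "insert (ExNum ?L) (lift_num ` ?\<Gamma>1)"
  let ?\<Gamma>3 = "insert ?L (lift_num ` ?\<Gamma>2)"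
  have E: "wff (Suc m) k ?E" using wff_diag_fm[OF B] by simp
  have L: "wff (Suc (Suc (Suc m))) k ?L"
    using wff_mono[OF B] by (simp add: wff_least_trace_fm)
  have "derives (Suc (Suc (Suc m))) k ?\<Gamma>3 ?C"
  proof (rule least_trace_unique[OF _ B])
    show "Q_axioms \<subseteq> ?\<Gamma>3" by (intro Q_insert Q_lift Q)
    show "derives (Suc (Suc (Suc m))) k ?\<Gamma>3 least_trace_fm" "derives (Suc (Suc (Suc m))) k ?\<Gamma>3 B"
      using AndE1[OF Assm_insert[OF L]] AndE2[OF Assm_insert[OF L]] by blast+
    \<comment> \<open>\<open>x\<close> was variable 0 when the equation was assumed; the fresh
      variables for \<open>w\<close> and \<open>y\<close> have shifted it to 2.\<close>
    have "derives (Suc (Suc (Suc m))) k ?\<Gamma>3 (lift_num (lift_num ?E))"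
    proof (rule Assm)
      show "wff (Suc (Suc (Suc m))) k (lift_num (lift_num ?E))"
        unfolding lift_num_def fsubst_compose by (rule wff_fsubst[OF E]) auto
    qed blast
    from AndE1[OF this[unfolded lift_num_simps]]
    show "derives (Suc (Suc (Suc m))) k ?\<Gamma>3 (EqNum (NVar 2) (numeral_of n))"
      by (simp add: numeral_2_eq_2)
  qed simp
  then have "derives (Suc (Suc m)) k ?\<Gamma>2 ?C"
    using L by - (rule ExNumE[OF Assm_insert], simp_all add: lift_C)
  then have "derives (Suc m) k ?\<Gamma>1 ?C"
    using AndE2[OF Assm_insert[OF E]] unfolding diag_fm_def
    by - (rule ExNumE[where A = "ExNum ?L"], simp_all add: lift_C)
  then show ?thesis
    using ExNumE[OF der[unfolded fixpoint_fm_def]] by (simp add: lift_C)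
qed

section \<open>The sentence of Yablo and Visser\<close>

text \<open>No index quantifier occurs, which is why relativisation leaves the arithmetical part of
  the fixed point alone.\<close>

lemma bounded_rel: "bounded A \<Longrightarrow> rel a A = A"
  by (induction arbitrary: a rule: bounded.induct) simp_all

lemma bounded_fsubst_idx: "bounded A \<Longrightarrow> fsubst NVar \<rho> A = A"
  by (induction rule: bounded.induct) simp_all

definition yablo_body :: fm where
  "yablo_body = AllIdx (Neg (Tr 0 (NVar 0)))"

definition yablo :: fm where
  "yablo = fixpoint_fm (gcode (diag_fm yablo_body)) yablo_body"

abbreviation yablo_num :: nterm where
  "yablo_num \<equiv> numeral_of (gcode yablo)"

text \<open>This is the self-reference: the number to which \<open>diag_fm\<close> applies the body
  is the code of the sentence itself.\<close>

lemma gcode_yablo: "gcode yablo = diag (gcode (diag_fm yablo_body))"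
  unfolding yablo_def fixpoint_fm_def by (rule gcode_diag)

lemma sentence_yablo: "sentence yablo"
  unfolding sentence_def yablo_def by (rule wff_fixpoint_fm) (simp add: yablo_body_def)

text \<open>Relativisation reaches only the body. The number inside still codes the unrelativised
  formula, so the truth predicate is still applied to the code of \<open>yablo\<close>.\<close>

lemma rel_yablo:
  "inst_idx a (rel 0 yablo) =
    fixpoint_fm (gcode (diag_fm yablo_body)) (AllIdx (Imp (Prec 0 (Suc a)) (Neg (Tr 0 (NVar 0)))))"
  by (simp add: inst_idx_def yablo_def fixpoint_fm_def diag_fm_def yablo_body_def
      bounded_rel bounded_fsubst_idx bounded_least_trace_fm)

lemma wff_rel: "wff m k A \<Longrightarrow> k \<le> k' \<Longrightarrow> a < k' \<Longrightarrow> wff m k' (rel a A)"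
proof (induction A arbitrary: m k k' a)
  case (Imp A B)
  then show ?case using Imp.IH[of m k k' a] by simp
next
  case (And A B)
  then show ?case using And.IH[of m k k' a] by simp
next
  case (Or A B)
  then show ?case using Or.IH[of m k k' a] by simp
next
  case (AllNum A)
  then show ?case using AllNum.IH[of "Suc m" k k' a] by simp
next
  case (ExNum A)
  then show ?case using ExNum.IH[of "Suc m" k k' a] by simp
next
  case (AllIdx A)
  then show ?case using AllIdx.IH[of m "Suc k" "Suc k'" "Suc a"] by simp
next
  case (ExIdx A)
  then show ?case using ExIdx.IH[of m "Suc k" "Suc k'" "Suc a"] by simp
qed simp_all

section \<open>Consequences of the biconditional for the diagonal sentence\<close>

lemma ITB_sentences:
  assumes "A \<in> ITB"
  shows "wff 0 0 A"
proof -
  have "wff 0 0 (bicond B)" if "sentence B" for B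
    using that wff_rel[of 0 0 B 1 0] by (simp add: bicond_def sentence_def)
  then show ?thesis
    using assms by (auto simp: ITB_def order_axioms_def dest: Q_sentences)
qed

lemma ITB_derives: "ITB \<subseteq> \<Gamma> \<Longrightarrow> A \<in> ITB \<Longrightarrow> derives m k \<Gamma> A"
  using wff_mono[OF ITB_sentences, of A m k] by (auto intro: Assm)

text \<open>Stated as an equivalence of derivabilities: the hypotheses are arbitrary beyond the
  theory, so it can be applied under any further assumptions.\<close>

lemma yablo_iff:
  assumes "ITB \<subseteq> \<Gamma>" "a < k"
  shows "derives m k \<Gamma> (Tr a yablo_num) \<longleftrightarrow>
    derives m k \<Gamma> (AllIdx (Imp (Prec 0 (Suc a)) (Neg (Tr 0 yablo_num))))"
proof -
  let ?B = "AllIdx (Imp (Prec 0 (Suc a)) (Neg (Tr 0 (NVar 0))))"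
  let ?F = "fixpoint_fm (gcode (diag_fm yablo_body)) ?B"
  have Q: "Q_axioms \<subseteq> \<Gamma>" using assms by (auto simp: ITB_def)
  have B: "wff 1 k ?B" using assms by simp
  have "derives m k \<Gamma> (bicond yablo)"
    using assms sentence_yablo by (intro ITB_derives) (auto simp: ITB_def)
  from AllIdxE[OF assms(2) this[unfolded bicond_def]]
  have iff: "derives m k \<Gamma> (Iff (Tr a yablo_num) ?F)"
    using rel_yablo[of a] by (simp add: inst_idx_def)
  have "derives m k \<Gamma> (Tr a yablo_num) \<longleftrightarrow> derives m k \<Gamma> ?F"
    using ImpE[OF AndE1[OF iff]] ImpE[OF AndE2[OF iff]] by blast
  also have "\<dots> \<longleftrightarrow> derives m k \<Gamma> (inst_num yablo_num ?B)"
    unfolding gcode_yablo using fixpoint_fmI[OF Q B] fixpoint_fmE[OF Q B] by blast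
  finally show ?thesis by (simp add: inst_num_def)
qed

lemma yablo_false_below:
  assumes "ITB \<subseteq> \<Gamma>" "a < k" "b < k"
    and "derives m k \<Gamma> (Tr a yablo_num)" "derives m k \<Gamma> (Prec b a)"
  shows "derives m k \<Gamma> (Neg (Tr b yablo_num))"
proof -
  have "derives m k \<Gamma> (AllIdx (Imp (Prec 0 (Suc a)) (Neg (Tr 0 yablo_num))))"
    using assms yablo_iff by blast
  from AllIdxE[OF assms(3) this] have "derives m k \<Gamma> (Imp (Prec b a) (Neg (Tr b yablo_num)))"
    by (simp add: inst_idx_def)
  then show ?thesis using assms(5) by (rule ImpE)
qed

lemma Prec_trans:
  assumes "ITB \<subseteq> \<Gamma>" "a < k" "b < k" "c < k"
    and "derives m k \<Gamma> (Prec a b)" "derives m k \<Gamma> (Prec b c)"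
  shows "derives m k \<Gamma> (Prec a c)"
proof -
  have "derives m k \<Gamma> (AllIdx (AllIdx (AllIdx (Imp (And (Prec 2 1) (Prec 1 0)) (Prec 2 0)))))"
    using assms(1) by (rule ITB_derives) (simp add: ITB_def order_axioms_def)
  from AllIdxE[OF assms(2) this]
  have "derives m k \<Gamma> (AllIdx (AllIdx (Imp (And (Prec (Suc (Suc a)) 1) (Prec 1 0)) (Prec (Suc (Suc a)) 0))))"
    by (simp add: inst_idx_def numeral_2_eq_2)
  from AllIdxE[OF assms(3) this]
  have "derives m k \<Gamma> (AllIdx (Imp (And (Prec (Suc a) (Suc b)) (Prec (Suc b) 0)) (Prec (Suc a) 0)))"
    by (simp add: inst_idx_def)
  from AllIdxE[OF assms(4) this] have "derives m k \<Gamma> (Imp (And (Prec a b) (Prec b c)) (Prec a c))"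
    by (simp add: inst_idx_def)
  then show ?thesis using assms(5,6) by (blast intro: ImpE AndI)
qed

lemma lift_idx_Fls: "lift_idx Fls = Fls"
  by (simp add: lift_idx_def)

section \<open>Contradiction from an index order without minimal elements\<close>

abbreviation no_minimal_index :: fm where
  "no_minimal_index \<equiv> AllIdx (ExIdx (Prec 0 1))"

lemma lift_idx_sentences:
  assumes "insert no_minimal_index ITB \<subseteq> \<Gamma>"
  shows "insert no_minimal_index ITB \<subseteq> lift_idx ` \<Gamma>"
proof
  fix A assume A: "A \<in> insert no_minimal_index ITB"
  then have "lift_idx A = A" using ITB_sentences by (auto intro!: lift_idx_sentence)
  then show "A \<in> lift_idx ` \<Gamma>" using A assms by (metis image_eqI subsetD)
qed

lemma yablo_false:
  assumes "insert no_minimal_index ITB \<subseteq> \<Gamma>" "a < k"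
  shows "derives m k \<Gamma> (Neg (Tr a yablo_num))"
proof (rule ImpI)
  let ?\<Gamma>0 = "insert (Tr a yablo_num) \<Gamma>"
  \<comment> \<open>In the first context variable 0 is an index below \<open>a\<close>. In the
    second it is an index below that one, which has become variable 1, while \<open>a\<close> has
    been shifted twice.\<close>
  let ?\<Gamma>1 = "insert (Prec 0 (Suc a)) (lift_idx ` ?\<Gamma>0)"
  let ?\<Gamma>2 = "insert (Prec 0 1) (lift_idx ` ?\<Gamma>1)"
  have S0: "insert no_minimal_index ITB \<subseteq> ?\<Gamma>0" using assms by blast
  then have S1: "insert no_minimal_index ITB \<subseteq> ?\<Gamma>1" using lift_idx_sentences by blast
  then have S2: "insert no_minimal_index ITB \<subseteq> ?\<Gamma>2" using lift_idx_sentences by blast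
  have "derives m (Suc k) ?\<Gamma>1 (Neg (Tr 0 yablo_num))"
    using S1 assms(2) by (intro yablo_false_below[where a = "Suc a"] Assm) (auto simp: lift_idx_def)
  moreover have "derives m (Suc (Suc k)) ?\<Gamma>2 (Neg (Tr 0 yablo_num))"
  proof (rule yablo_false_below[where a = "Suc (Suc a)"])
    have "derives m (Suc (Suc k)) ?\<Gamma>2 (Prec 0 1)" "derives m (Suc (Suc k)) ?\<Gamma>2 (Prec 1 (Suc (Suc a)))"
      using assms(2) by (auto intro!: Assm simp: lift_idx_def)
    then show "derives m (Suc (Suc k)) ?\<Gamma>2 (Prec 0 (Suc (Suc a)))"
      using S2 assms(2) by - (rule Prec_trans[where b = 1], auto)
    show "derives m (Suc (Suc k)) ?\<Gamma>2 (Tr (Suc (Suc a)) yablo_num)"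
      using assms(2) by (intro Assm) (auto simp: lift_idx_def)
  qed (use S2 assms in auto)
  \<comment> \<open>Falsity everywhere below the chosen index is the relativised sentence there, so
    the sentence is true at an index where it was just refuted.\<close>
  then have "derives m (Suc k) ?\<Gamma>1 (AllIdx (Imp (Prec 0 1) (Neg (Tr 0 yablo_num))))"
    by - (rule AllIdxI, rule ImpI, simp_all)
  then have "derives m (Suc k) ?\<Gamma>1 (Tr 0 yablo_num)"
    using S1 yablo_iff[of ?\<Gamma>1 0 "Suc k" m] by simp
  ultimately have F: "derives m (Suc k) ?\<Gamma>1 Fls" by (rule ImpE)
  \<comment> \<open>The absence of minimal indices provides the index below \<open>a\<close> that
    the contradiction assumed.\<close>
  have "derives m k ?\<Gamma>0 no_minimal_index" using S0 by (intro Assm) auto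
  from AllIdxE[OF assms(2) this] have "derives m k ?\<Gamma>0 (ExIdx (Prec 0 (Suc a)))"
    by (simp add: inst_idx_def)
  then show "derives m k ?\<Gamma>0 Fls"
    using F by (rule ExIdxE[where C = Fls, unfolded lift_idx_Fls])
qed (use assms in simp)

text \<open>By \<open>yablo_false\<close> the sentence is false at all indices, in particular at all
  those below a given one, which makes it true there. \<open>index_exists\<close> provides such an
  index, since the sort could be empty.\<close>

lemma no_minimal_index_inconsistent:
  assumes "insert no_minimal_index ITB \<subseteq> \<Gamma>" "index_exists \<in> \<Gamma>"
  shows "derives m k \<Gamma> Fls"
proof -
  let ?\<Gamma>1 = "insert (EqIdx 0 0) (lift_idx ` \<Gamma>)"
  let ?\<Gamma>2 = "insert (Prec 0 1) (lift_idx ` ?\<Gamma>1)"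
  have S1: "insert no_minimal_index ITB \<subseteq> ?\<Gamma>1" using lift_idx_sentences[OF assms(1)] by blast
  then have S2: "insert no_minimal_index ITB \<subseteq> ?\<Gamma>2" using lift_idx_sentences by blast
  have "derives m (Suc k) ?\<Gamma>1 (AllIdx (Imp (Prec 0 1) (Neg (Tr 0 yablo_num))))"
    using yablo_false[OF S2] by - (rule AllIdxI, rule ImpI, simp_all)
  then have "derives m (Suc k) ?\<Gamma>1 (Tr 0 yablo_num)"
    using S1 yablo_iff[of ?\<Gamma>1 0 "Suc k" m] by simp
  with yablo_false[OF S1] have F: "derives m (Suc k) ?\<Gamma>1 Fls" by (blast intro: ImpE)
  have "derives m k \<Gamma> (ExIdx (EqIdx 0 0))"
    using assms(2) unfolding index_exists_def by (rule Assm) simp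
  then show ?thesis using F by (rule ExIdxE[where C = Fls, unfolded lift_idx_Fls])
qed

theorem theorem3p2:
  shows "ITB \<union> {index_exists} \<turnstile> minimal_index_exists \<and> inconsistent DTB"
proof
  let ?N = "Neg minimal_index_exists"
  let ?\<Gamma> = "insert ?N (ITB \<union> {index_exists})"
  have minimal: "minimal_index_exists = ExIdx (Neg (ExIdx (Prec 0 1)))"
    by (rule minimal_index_exists_def)
  \<comment> \<open>Classically, if no index is minimal, then each has one below it. This reduces
    the first claim to the inconsistency that also settles the second.\<close>
  have "derives 0 0 ?\<Gamma> no_minimal_index"
  proof (rule AllIdxI, rule Raa)
    let ?\<Delta> = "insert (Neg (ExIdx (Prec 0 1))) (lift_idx ` ?\<Gamma>)"
    have "derives 0 (Suc 0) ?\<Delta> minimal_index_exists"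
      unfolding minimal
      by (intro ExIdxI[where a = 0]) (auto simp: inst_idx_def intro!: Assm_insert)
    moreover have "derives 0 (Suc 0) ?\<Delta> ?N"
      by (rule Assm) (auto simp: minimal lift_idx_def)
    ultimately show "derives 0 (Suc 0) ?\<Delta> Fls" by (blast intro: ImpE)
  qed simp
  then have "derives 0 0 ?\<Gamma> Fls"
    by (rule cut) (auto intro!: no_minimal_index_inconsistent)
  then show "ITB \<union> {index_exists} \<turnstile> minimal_index_exists"
    unfolding proves_def by (rule Raa[rotated]) (simp add: minimal)
  show "inconsistent DTB"
    unfolding inconsistent_def proves_def
    by (rule no_minimal_index_inconsistent) (auto simp: DTB_def)
qed

end
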